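(* Let $\alpha$ be a positive integer and $X\subseteq\mathbb{Z}_{2^\alpha}\setminus\{0\}$. Then the dihedrant $Dih(2^\alpha,X,X)$ is a (genuine) directed strongly regular graph if and only if $X=\psi_{\gamma}^{-1}(H)$ for some $2\leqslant\gamma\leqslant\alpha$ and some subset $H\subseteq\mathbb{Z}_{2^\gamma}$ satisfying: (i) $H\uplus(-H)=(\mathbb{Z}_{2^\gamma}\setminus\{0\})\uplus\{2^{\gamma-1}\}$ (as multisets); (ii) $H\cap(2^{\gamma-1}+H)=\emptyset$.
   Context: For a positive integer $n$, $D_n=\langle x,a\mid x^n=1,\ a^2=1,\ ax=x^{-1}a\rangle$. For $X,Y\subseteq\mathbb{Z}_n$ with $0\notin X$, $Dih(n,X,Y)$ denotes the Cayley digraph on $D_n$ with connection set $S=\{x^i:i\in X\}\cup\{x^ja:j\in Y\}$ (arc $g\to h$ iff $g^{-1}h\in S$). A DSRG with parameters $(n,k,\mu,\lambda,t)$ is a digraph on $n$ vertices with adjacency matrix $A$ satisfying $AJ=JA=kJ$ and $A^2=tI+\lambda A+\mu(J-I-A)$; DSRGs are required to be genuine, i.e. $0<t<k$. $\psi_\gamma:\mathbb{Z}_{2^\alpha}\to\mathbb{Z}_{2^\gamma}$ is reduction mod $2^\gamma$, and $\psi_\gamma^{-1}(H)$ the full preimage. $A\uplus B$ denotes multiset union (multiplicities add); $-H=\{-h:h\in H\}$, $c+H=\{c+h:h\in H\}$. *)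

theory Defs
  imports
    "HOL-Algebra.Elementary_Groups"
    "HOL-Algebra.Generated_Groups"
    "HOL-Library.Multiset"
    "Graph_Theory.Pair_Digraph"
    "Jordan_Normal_Form.Matrix"
begin

text \<open>The pair \<open>(i, e)\<close> stands for the normal form \<open>x\<^sup>i a\<^sup>e\<close>, with \<open>e\<close> read as an exponent
  0 (False) or 1 (True). The lemmas below show that this is the group with the presentation
  \<open>x\<^sup>n = 1, a\<^sup>2 = 1, a x = x\<^sup>-\<^sup>1 a\<close>.\<close>

definition dihedral_group :: "nat \<Rightarrow> (int \<times> bool) monoid" where
  "dihedral_group n =
    \<lparr>carrier = carrier (integer_mod_group n) \<times> UNIV,
     monoid.mult = (\<lambda>(i, e) (j, f).
       (i \<otimes>\<^bsub>integer_mod_group n\<^esub> (if e then inv\<^bsub>integer_mod_group n\<^esub> j else j), e \<noteq> f)),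
     one = (\<one>\<^bsub>integer_mod_group n\<^esub>, False)\<rparr>"

definition dih_x :: "nat \<Rightarrow> int \<times> bool" where
  "dih_x n = (1 mod int n, False)"

definition dih_a :: "nat \<Rightarrow> int \<times> bool" where
  "dih_a n = (0, True)"

lemma mod_in_carrier: "i mod int n \<in> carrier (integer_mod_group n)"
  by (simp add: carrier_integer_mod_group)

lemma carrier_modD: "i \<in> carrier (integer_mod_group n) \<Longrightarrow> i mod int n = i"
  by (auto simp: carrier_integer_mod_group split: if_splits)

lemma carrier_dihedral_group:
  "carrier (dihedral_group n) = carrier (integer_mod_group n) \<times> UNIV"
  by (simp add: dihedral_group_def)

lemma one_dihedral_group: "\<one>\<^bsub>dihedral_group n\<^esub> = (0, False)"
  by (simp add: dihedral_group_def)

lemma mult_dihedral_group: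
  assumes "j \<in> carrier (integer_mod_group n)"
  shows "(i, e) \<otimes>\<^bsub>dihedral_group n\<^esub> (j, f) = ((i + (if e then - j else j)) mod int n, e \<noteq> f)"
  using assms by (simp add: dihedral_group_def mod_simps)

lemma group_dihedral_group: "group (dihedral_group n)"
proof (rule groupI)
  fix p q assume "p \<in> carrier (dihedral_group n)" "q \<in> carrier (dihedral_group n)"
  then show "p \<otimes>\<^bsub>dihedral_group n\<^esub> q \<in> carrier (dihedral_group n)"
    by (cases p; cases q)
      (simp add: carrier_dihedral_group mult_dihedral_group mod_in_carrier)
next
  show "\<one>\<^bsub>dihedral_group n\<^esub> \<in> carrier (dihedral_group n)"
    by (simp add: carrier_dihedral_group one_dihedral_group)
next
  fix p q r
  assume "p \<in> carrier (dihedral_group n)" "q \<in> carrier (dihedral_group n)"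
    "r \<in> carrier (dihedral_group n)"
  then show "p \<otimes>\<^bsub>dihedral_group n\<^esub> q \<otimes>\<^bsub>dihedral_group n\<^esub> r =
      p \<otimes>\<^bsub>dihedral_group n\<^esub> (q \<otimes>\<^bsub>dihedral_group n\<^esub> r)"
    by (cases p; cases q; cases r)
      (auto simp: carrier_dihedral_group mult_dihedral_group mod_in_carrier mod_simps algebra_simps)
next
  fix p assume "p \<in> carrier (dihedral_group n)"
  then show "\<one>\<^bsub>dihedral_group n\<^esub> \<otimes>\<^bsub>dihedral_group n\<^esub> p = p"
    by (cases p) (simp add: carrier_dihedral_group one_dihedral_group mult_dihedral_group carrier_modD)
next
  fix p assume p: "p \<in> carrier (dihedral_group n)"
  obtain i e where ie: "p = (i, e)" by (cases p)
  have "((if e then i else - i) mod int n, e) \<in> carrier (dihedral_group n)"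
    by (simp add: carrier_dihedral_group mod_in_carrier)
  moreover have "((if e then i else - i) mod int n, e) \<otimes>\<^bsub>dihedral_group n\<^esub> p
      = \<one>\<^bsub>dihedral_group n\<^esub>"
    using p by (simp add: ie carrier_dihedral_group one_dihedral_group mult_dihedral_group mod_simps)
  ultimately show "\<exists>q\<in>carrier (dihedral_group n). q \<otimes>\<^bsub>dihedral_group n\<^esub> p = \<one>\<^bsub>dihedral_group n\<^esub>"
    by blast
qed

lemma order_dihedral_group: "n > 0 \<Longrightarrow> order (dihedral_group n) = 2 * n"
  by (simp add: order_def carrier_dihedral_group carrier_integer_mod_group card_cartesian_product)

lemma dih_x_closed: "dih_x n \<in> carrier (dihedral_group n)"
  by (simp add: dih_x_def carrier_dihedral_group mod_in_carrier)

lemma dih_a_closed: "dih_a n \<in> carrier (dihedral_group n)"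
  by (simp add: dih_a_def carrier_dihedral_group)

lemma inv_dihedral_group:
  assumes "i \<in> carrier (integer_mod_group n)"
  shows "inv\<^bsub>dihedral_group n\<^esub> (i, e) = ((if e then i else - i) mod int n, e)"
  by (rule group.inv_equality[OF group_dihedral_group])
    (use assms in \<open>auto simp: carrier_dihedral_group one_dihedral_group mult_dihedral_group
      mod_in_carrier mod_simps\<close>)

lemma dih_x_pow: "dih_x n [^]\<^bsub>dihedral_group n\<^esub> (m::nat) = (int m mod int n, False)"
proof (induction m)
  case 0
  then show ?case by (simp add: one_dihedral_group)
next
  case (Suc m)
  then show ?case
    by (simp add: dih_x_def mult_dihedral_group mod_in_carrier mod_simps add.commute)
qed

lemma dih_x_int_pow: "dih_x n [^]\<^bsub>dihedral_group n\<^esub> (i::int) = (i mod int n, False)"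
proof (cases "i \<ge> 0")
  case True
  then obtain m where "i = int m" using nonneg_int_cases by blast
  then show ?thesis by (simp add: int_pow_int dih_x_pow)
next
  case False
  then obtain m where m: "i = - int m" by (metis int_cases3 linorder_le_cases of_nat_0_le_iff)
  then show ?thesis
    using group.int_pow_neg_int[OF group_dihedral_group dih_x_closed, of n m]
    by (simp add: dih_x_pow inv_dihedral_group mod_in_carrier mod_simps)
qed

lemma dihedral_relations:
  "dih_x n [^]\<^bsub>dihedral_group n\<^esub> n = \<one>\<^bsub>dihedral_group n\<^esub>"
  "dih_a n [^]\<^bsub>dihedral_group n\<^esub> (2::nat) = \<one>\<^bsub>dihedral_group n\<^esub>"
  "dih_a n \<otimes>\<^bsub>dihedral_group n\<^esub> dih_x n =
    inv\<^bsub>dihedral_group n\<^esub> (dih_x n) \<otimes>\<^bsub>dihedral_group n\<^esub> dih_a n"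
proof -
  show "dih_x n [^]\<^bsub>dihedral_group n\<^esub> n = \<one>\<^bsub>dihedral_group n\<^esub>"
    by (simp add: dih_x_pow one_dihedral_group)
  show "dih_a n [^]\<^bsub>dihedral_group n\<^esub> (2::nat) = \<one>\<^bsub>dihedral_group n\<^esub>"
    by (simp add: numeral_2_eq_2 dih_a_def one_dihedral_group mult_dihedral_group)
  show "dih_a n \<otimes>\<^bsub>dihedral_group n\<^esub> dih_x n =
    inv\<^bsub>dihedral_group n\<^esub> (dih_x n) \<otimes>\<^bsub>dihedral_group n\<^esub> dih_a n"
    by (simp add: dih_a_def dih_x_def inv_dihedral_group mult_dihedral_group mod_in_carrier mod_simps)
qed

lemma dihedral_normal_form:
  assumes "(i, e) \<in> carrier (dihedral_group n)"
  shows "(i, e) = (if e then dih_x n [^]\<^bsub>dihedral_group n\<^esub> i \<otimes>\<^bsub>dihedral_group n\<^esub> dih_a n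
    else dih_x n [^]\<^bsub>dihedral_group n\<^esub> i)"
  using assms
  by (simp add: dih_x_int_pow dih_a_def carrier_dihedral_group mult_dihedral_group carrier_modD)

lemma dihedral_generated:
  "generate (dihedral_group n) {dih_x n, dih_a n} = carrier (dihedral_group n)"
proof -
  interpret D: group "dihedral_group n" by (rule group_dihedral_group)
  let ?K = "generate (dihedral_group n) {dih_x n, dih_a n}"
  have sub: "subgroup ?K (dihedral_group n)"
    by (rule D.generate_is_subgroup) (simp add: dih_x_closed dih_a_closed)
  have gens: "dih_x n \<in> ?K" "dih_a n \<in> ?K" by (auto intro: generate.incl)
  have "p \<in> ?K" if "p \<in> carrier (dihedral_group n)" for p
  proof -
    obtain i e where p: "p = (i, e)" by (cases p)
    have "dih_x n [^]\<^bsub>dihedral_group n\<^esub> i \<in> ?K"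
      using D.subgroup_int_pow_closed[OF sub gens(1)] .
    then show ?thesis
      using dihedral_normal_form[of i e n] that gens(2) subgroup.m_closed[OF sub] unfolding p
      by (cases e) (metis (full_types))+
  qed
  then show ?thesis using subgroup.subset[OF sub] by blast
qed

text \<open>Universal property of the presentation; uniqueness of the homomorphism
  on the carrier is clear as \<open>x\<close> and \<open>a\<close> generate.\<close>

lemma dihedral_universal:
  assumes G: "group G" and u: "u \<in> carrier G" and v: "v \<in> carrier G"
    and rel: "u [^]\<^bsub>G\<^esub> n = \<one>\<^bsub>G\<^esub>" "v [^]\<^bsub>G\<^esub> (2::nat) = \<one>\<^bsub>G\<^esub>"
      "v \<otimes>\<^bsub>G\<^esub> u = inv\<^bsub>G\<^esub> u \<otimes>\<^bsub>G\<^esub> v"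
  shows "\<exists>h \<in> hom (dihedral_group n) G. h (dih_x n) = u \<and> h (dih_a n) = v"
proof -
  interpret group G by (rule G)
  have vv: "v \<otimes>\<^bsub>G\<^esub> v = \<one>\<^bsub>G\<^esub>" using rel(2) v by (simp add: numeral_2_eq_2)
  have red: "u [^]\<^bsub>G\<^esub> (i mod int n) = u [^]\<^bsub>G\<^esub> i" for i :: int
  proof -
    have "u [^]\<^bsub>G\<^esub> i = u [^]\<^bsub>G\<^esub> (int n * (i div int n) + i mod int n)" by simp
    also have "\<dots> = u [^]\<^bsub>G\<^esub> (int n * (i div int n)) \<otimes>\<^bsub>G\<^esub> u [^]\<^bsub>G\<^esub> (i mod int n)"
      using u by (rule int_pow_mult)
    also have "u [^]\<^bsub>G\<^esub> (int n * (i div int n)) = (u [^]\<^bsub>G\<^esub> (int n)) [^]\<^bsub>G\<^esub> (i div int n)"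
      using u by (simp add: int_pow_pow)
    also have "\<dots> = \<one>\<^bsub>G\<^esub>" by (simp add: int_pow_int rel(1))
    finally show ?thesis using u by simp
  qed
  have swapn: "v \<otimes>\<^bsub>G\<^esub> u [^]\<^bsub>G\<^esub> m = inv\<^bsub>G\<^esub> (u [^]\<^bsub>G\<^esub> m) \<otimes>\<^bsub>G\<^esub> v" for m :: nat
  proof (induction m)
    case 0
    then show ?case using v by simp
  next
    case (Suc m)
    have "v \<otimes>\<^bsub>G\<^esub> u [^]\<^bsub>G\<^esub> Suc m = (v \<otimes>\<^bsub>G\<^esub> u [^]\<^bsub>G\<^esub> m) \<otimes>\<^bsub>G\<^esub> u"
      using u v by (simp add: m_assoc)
    also have "\<dots> = inv\<^bsub>G\<^esub> (u [^]\<^bsub>G\<^esub> m) \<otimes>\<^bsub>G\<^esub> (v \<otimes>\<^bsub>G\<^esub> u)"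
      using u v by (simp add: Suc m_assoc)
    also have "\<dots> = inv\<^bsub>G\<^esub> (u \<otimes>\<^bsub>G\<^esub> u [^]\<^bsub>G\<^esub> m) \<otimes>\<^bsub>G\<^esub> v"
      using u v by (simp add: rel(3) m_assoc inv_mult_group)
    finally show ?case using u by (simp add: nat_pow_Suc2[symmetric])
  qed
  have swap: "v \<otimes>\<^bsub>G\<^esub> u [^]\<^bsub>G\<^esub> i = u [^]\<^bsub>G\<^esub> (- i) \<otimes>\<^bsub>G\<^esub> v" for i :: int
  proof (cases "i \<ge> 0")
    case True
    then obtain m where "i = int m" using nonneg_int_cases by blast
    then show ?thesis using swapn[of m] u by (simp add: int_pow_int int_pow_neg)
  next
    case False
    then obtain m where m: "i = - int m" by (metis int_cases3 linorder_le_cases of_nat_0_le_iff)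
    have P: "u [^]\<^bsub>G\<^esub> m \<in> carrier G" using u by simp
    have "v \<otimes>\<^bsub>G\<^esub> inv\<^bsub>G\<^esub> (u [^]\<^bsub>G\<^esub> m) = v \<otimes>\<^bsub>G\<^esub> (inv\<^bsub>G\<^esub> (u [^]\<^bsub>G\<^esub> m) \<otimes>\<^bsub>G\<^esub> v) \<otimes>\<^bsub>G\<^esub> v"
      using P v vv by (simp add: m_assoc)
    also have "\<dots> = (v \<otimes>\<^bsub>G\<^esub> v) \<otimes>\<^bsub>G\<^esub> u [^]\<^bsub>G\<^esub> m \<otimes>\<^bsub>G\<^esub> v"
      using P v by (simp add: swapn[symmetric] m_assoc)
    finally show ?thesis using P v u vv by (simp add: m int_pow_int int_pow_neg)
  qed
  define h where "h = (\<lambda>(i::int, e). u [^]\<^bsub>G\<^esub> i \<otimes>\<^bsub>G\<^esub> (if e then v else \<one>\<^bsub>G\<^esub>))"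
  have "h (p \<otimes>\<^bsub>dihedral_group n\<^esub> q) = h p \<otimes>\<^bsub>G\<^esub> h q"
    if pq: "p \<in> carrier (dihedral_group n)" "q \<in> carrier (dihedral_group n)" for p q
  proof -
    obtain i e j f where e: "p = (i, e)" "q = (j, f)" by (cases p; cases q)
    have j: "j \<in> carrier (integer_mod_group n)"
      using pq by (simp add: e carrier_dihedral_group)
    have c: "u [^]\<^bsub>G\<^esub> k \<in> carrier G" for k :: int using u by simp
    have vw: "v \<otimes>\<^bsub>G\<^esub> (u [^]\<^bsub>G\<^esub> k \<otimes>\<^bsub>G\<^esub> w) = u [^]\<^bsub>G\<^esub> (- k) \<otimes>\<^bsub>G\<^esub> (v \<otimes>\<^bsub>G\<^esub> w)"
      if "w \<in> carrier G" for k :: int and w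
      using that swap[of k] c v by (metis m_assoc)
    have s: "u [^]\<^bsub>G\<^esub> (i - j) = u [^]\<^bsub>G\<^esub> i \<otimes>\<^bsub>G\<^esub> u [^]\<^bsub>G\<^esub> (- j)"
      using int_pow_mult[OF u, of i "- j"] by simp
    show ?thesis
      using v vv c j
      by (cases e; cases f)
        (simp_all add: e h_def mult_dihedral_group red int_pow_mult u s vw swap m_assoc)
  qed
  moreover have "h p \<in> carrier G" for p using u v by (auto simp: h_def split: prod.split)
  ultimately have "h \<in> hom (dihedral_group n) G" by (auto intro: homI)
  moreover have "h (dih_x n) = u" using u by (simp add: h_def dih_x_def red)
  moreover have "h (dih_a n) = v" using v by (simp add: h_def dih_a_def)
  ultimately show ?thesis by blast
qed

definition cayley_digraph :: "('a, 'b) monoid_scheme \<Rightarrow> 'a set \<Rightarrow> 'a pair_pre_digraph" where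
  "cayley_digraph G S =
    \<lparr>pverts = carrier G,
     parcs = {(g, h). g \<in> carrier G \<and> h \<in> carrier G \<and> inv\<^bsub>G\<^esub> g \<otimes>\<^bsub>G\<^esub> h \<in> S}\<rparr>"

definition Dih :: "nat \<Rightarrow> int set \<Rightarrow> int set \<Rightarrow> (int \<times> bool) pair_pre_digraph" where
  "Dih n X Y = cayley_digraph (dihedral_group n)
    ({dih_x n [^]\<^bsub>dihedral_group n\<^esub> i | i. i \<in> X} \<union>
     {dih_x n [^]\<^bsub>dihedral_group n\<^esub> j \<otimes>\<^bsub>dihedral_group n\<^esub> dih_a n | j. j \<in> Y})"

definition adjacency_matrix :: "'a pair_pre_digraph \<Rightarrow> 'a list \<Rightarrow> int mat" where
  "adjacency_matrix G vs =
    mat (length vs) (length vs) (\<lambda>(i, j). if (vs ! i, vs ! j) \<in> parcs G then 1 else 0)"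

definition all_ones_mat :: "nat \<Rightarrow> int mat" where
  "all_ones_mat n = mat n n (\<lambda>_. 1)"

text \<open>The adjacency matrix is taken with respect to some enumeration \<open>vs\<close> of the vertices;
  by \<open>dsrg_any_enumeration\<close> below, the choice is irrelevant. The condition \<open>0 < t < k\<close>
  (genuineness) is part of the notion.\<close>

definition dsrg :: "'a pair_pre_digraph \<Rightarrow> nat \<Rightarrow> nat \<Rightarrow> nat \<Rightarrow> nat \<Rightarrow> nat \<Rightarrow> bool" where
  "dsrg G n k \<mu> l t \<longleftrightarrow>
    pair_digraph G \<and> card (pverts G) = n \<and> 0 < t \<and> t < k \<and>
    (\<exists>vs. distinct vs \<and> set vs = pverts G \<and>
      (let A = adjacency_matrix G vs; J = all_ones_mat n; I = 1\<^sub>m n in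
        A * J = int k \<cdot>\<^sub>m J \<and> J * A = int k \<cdot>\<^sub>m J \<and>
        A * A = int t \<cdot>\<^sub>m I + int l \<cdot>\<^sub>m A + int \<mu> \<cdot>\<^sub>m (J - I - A)))"

definition is_dsrg :: "'a pair_pre_digraph \<Rightarrow> bool" where
  "is_dsrg G \<longleftrightarrow> (\<exists>n k \<mu> l t. dsrg G n k \<mu> l t)"

lemma sum_nth_enum:
  "distinct vs \<Longrightarrow> (\<Sum>i = 0..<length vs. f (vs ! i)) = (\<Sum>v\<in>set vs. f v)"
  by (simp add: sum_list_distinct_conv_sum_set[symmetric] sum_list_sum_nth)

lemma dsrg_matrix_iff:
  assumes "distinct vs" "set vs = V" "card V = n" "V = pverts G"
  defines "A \<equiv> adjacency_matrix G vs" and "J \<equiv> all_ones_mat n" and "I \<equiv> 1\<^sub>m n"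
    and "a \<equiv> \<lambda>u v. if (u, v) \<in> parcs G then 1 else (0::int)"
  shows "A * J = int k \<cdot>\<^sub>m J \<and> J * A = int k \<cdot>\<^sub>m J \<and>
      A * A = int t \<cdot>\<^sub>m I + int l \<cdot>\<^sub>m A + int \<mu> \<cdot>\<^sub>m (J - I - A) \<longleftrightarrow>
    (\<forall>u\<in>V. (\<Sum>w\<in>V. a u w) = int k) \<and> (\<forall>v\<in>V. (\<Sum>w\<in>V. a w v) = int k) \<and>
    (\<forall>u\<in>V. \<forall>v\<in>V. (\<Sum>w\<in>V. a u w * a w v) =
      (if u = v then int t else 0) + int l * a u v +
      int \<mu> * (1 - (if u = v then 1 else 0) - a u v))"
proof -
  have n: "n = length vs" using assms(1-3) distinct_card by blast
  note d = A_def J_def I_def adjacency_matrix_def all_ones_mat_def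
  have nth: "(\<forall>u\<in>V. P u) \<longleftrightarrow> (\<forall>i<n. P (vs ! i))" for P
    using assms(2) n by (metis in_set_conv_nth)
  have dims: "dim_row A = n" "dim_col A = n" "dim_row J = n" "dim_col J = n"
    "dim_row I = n" "dim_col I = n" by (simp_all add: d n)
  have Aij: "A $$ (i, j) = a (vs ! i) (vs ! j)" if "i < n" "j < n" for i j
    using that by (simp add: d n a_def)
  have Jij: "J $$ (i, j) = 1" if "i < n" "j < n" for i j using that by (simp add: d)
  have Iij: "I $$ (i, j) = (if vs ! i = vs ! j then 1 else 0)" if "i < n" "j < n" for i j
    using that assms(1) n by (simp add: d nth_eq_iff_index_eq)
  have s: "(\<Sum>i = 0..<n. f (vs ! i)) = (\<Sum>v\<in>V. f v)" for f :: "'a \<Rightarrow> int"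
    using sum_nth_enum[OF assms(1)] assms(2) n by simp
  have prod: "(M * N) $$ (i, j) = (\<Sum>r = 0..<n. M $$ (i, r) * N $$ (r, j))"
    if "i < n" "j < n" "dim_row M = n" "dim_col M = n" "dim_row N = n" "dim_col N = n"
    for i j and M N :: "int mat"
    using that by (simp add: scalar_prod_def)
  have AJ: "(A * J) $$ (i, j) = (\<Sum>w\<in>V. a (vs ! i) w)" if "i < n" "j < n" for i j
    using that by (simp add: prod dims Aij Jij s del: index_mult_mat(1))
  have JA: "(J * A) $$ (i, j) = (\<Sum>w\<in>V. a w (vs ! j))" if "i < n" "j < n" for i j
    using that s[of "\<lambda>w. a w (vs ! j)"] by (simp add: prod dims Aij Jij del: index_mult_mat(1))
  have AA: "(A * A) $$ (i, j) = (\<Sum>w\<in>V. a (vs ! i) w * a w (vs ! j))" if "i < n" "j < n" for i j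
    using that s[of "\<lambda>w. a (vs ! i) w * a w (vs ! j)"]
    by (simp add: prod dims Aij del: index_mult_mat(1))
  have eq: "M = N \<longleftrightarrow> (\<forall>i<n. \<forall>j<n. M $$ (i, j) = N $$ (i, j))"
    if "dim_row M = n" "dim_col M = n" "dim_row N = n" "dim_col N = n" for M N :: "int mat"
    using that by (auto intro: eq_matI)
  have e1: "A * J = int k \<cdot>\<^sub>m J \<longleftrightarrow> (\<forall>u\<in>V. (\<Sum>w\<in>V. a u w) = int k)"
    by (subst eq) (auto simp: dims AJ Jij nth simp del: index_mult_mat(1))
  have e2: "J * A = int k \<cdot>\<^sub>m J \<longleftrightarrow> (\<forall>v\<in>V. (\<Sum>w\<in>V. a w v) = int k)"
    by (subst eq) (auto simp: dims JA Jij nth simp del: index_mult_mat(1))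
  have rhs: "(int t \<cdot>\<^sub>m I + int l \<cdot>\<^sub>m A + int \<mu> \<cdot>\<^sub>m (J - I - A)) $$ (i, j) =
      (if vs ! i = vs ! j then int t else 0) + int l * a (vs ! i) (vs ! j) +
      int \<mu> * (1 - (if vs ! i = vs ! j then 1 else 0) - a (vs ! i) (vs ! j))"
    if "i < n" "j < n" for i j
    using that by (simp add: dims Aij Jij Iij)
  have e3: "A * A = int t \<cdot>\<^sub>m I + int l \<cdot>\<^sub>m A + int \<mu> \<cdot>\<^sub>m (J - I - A) \<longleftrightarrow>
    (\<forall>u\<in>V. \<forall>v\<in>V. (\<Sum>w\<in>V. a u w * a w v) =
      (if u = v then int t else 0) + int l * a u v +
      int \<mu> * (1 - (if u = v then 1 else 0) - a u v))"
    unfolding nth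
    by (subst eq)
      (simp_all add: dims AA rhs del: index_mult_mat(1) index_add_mat(1) index_smult_mat(1)
        index_minus_mat(1))
  show ?thesis by (simp only: e1 e2 e3)
qed

lemma dsrg_any_enumeration:
  assumes "dsrg G n k \<mu> l t" "distinct vs" "set vs = pverts G"
  defines "A \<equiv> adjacency_matrix G vs" and "J \<equiv> all_ones_mat n" and "I \<equiv> 1\<^sub>m n"
  shows "A * J = int k \<cdot>\<^sub>m J \<and> J * A = int k \<cdot>\<^sub>m J \<and>
    A * A = int t \<cdot>\<^sub>m I + int l \<cdot>\<^sub>m A + int \<mu> \<cdot>\<^sub>m (J - I - A)"
proof -
  obtain ws where ws: "distinct ws" "set ws = pverts G" and c: "card (pverts G) = n"
    and eqs: "adjacency_matrix G ws * J = int k \<cdot>\<^sub>m J \<and> J * adjacency_matrix G ws = int k \<cdot>\<^sub>m J \<and>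
      adjacency_matrix G ws * adjacency_matrix G ws =
        int t \<cdot>\<^sub>m I + int l \<cdot>\<^sub>m adjacency_matrix G ws + int \<mu> \<cdot>\<^sub>m (J - I - adjacency_matrix G ws)"
    using assms(1) unfolding dsrg_def Let_def J_def I_def by blast
  show ?thesis
    using eqs unfolding A_def J_def I_def
      dsrg_matrix_iff[OF ws c refl] dsrg_matrix_iff[OF assms(2,3) c refl] .
qed

definition psi :: "nat \<Rightarrow> int \<Rightarrow> int" where
  "psi \<gamma> i = i mod 2 ^ \<gamma>"

end

theory Submission
  imports
    Defs
    "HOL-Computational_Algebra.Polynomial_Factorial"
    "HOL-Library.Z2"
    "Jordan_Normal_Form.Char_Poly"
begin

text \<open>Identify \<open>X\<close> with a \<open>2\<^sup>\<alpha>\<close>-periodic 0/1-function \<open>x\<close> on the integers and put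
  \<open>F j = x j + x (- j)\<close>. Since \<open>S = X (1 + a)\<close> in the group ring, the dihedrant is a DSRG iff the cyclic convolution
  satisfies \<open>x * F = (\<lambda> - t) x + t\<close> with \<open>0 < t < 2 |X|\<close>, and then \<open>\<mu> = t\<close>.

  Let \<open>M = 2\<^sup>\<gamma> = 2 m\<close> be the least 2-power period of \<open>x\<close>; then the equation also holds
  modulo \<open>M\<close>, with
  some \<open>\<delta>\<close> in place of \<open>\<lambda> - t\<close>. It says that \<open>x * (F - \<delta> 1\<^sub>0)\<close> is constant. As \<open>T\<^sup>m + 1\<close> is prime in
  \<open>\<int>[T]\<close>, one of the two factors has period \<open>m\<close>, and \<open>x\<close> does not. This forces \<open>\<delta> = - 2\<close> and makes
  \<open>K = F + 1\<^sub>0 - 1\<^sub>m\<close> have period \<open>m\<close>. The sum of the squares of \<open>K i - K (i - h)\<close> over the residues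
  modulo \<open>m\<close> is \<open>2 (K h - 1)\<close>, and as \<open>K \<le> 2\<close> this leaves only \<open>K = 1\<close> everywhere, which is the
  claimed structure, or \<open>K = 2\<close> off the multiples of \<open>m\<close>, where \<open>t = k\<close>.\<close>

section \<open>Cyclotomic polynomials of 2-power order\<close>

text \<open>As \<open>f\<close> does not vanish at \<open>a\<close>, each factor
  \<open>[:- a, 1:]\<close> of the power must divide the cofactor, where it can be
  cancelled.\<close>

lemma dvd_linear_power_imp_degree_0:
  fixes f :: "'a::field poly"
  assumes "poly f a \<noteq> 0" and "f dvd [:- a, 1:] ^ n"
  shows "degree f = 0"
  using assms(2)
proof (induction n)
  case 0
  then show ?case by (metis degree_1 dvd_imp_degree_le le_zero_eq one_neq_zero power_0)
next
  case (Suc n)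
  obtain w where w: "[:- a, 1:] ^ Suc n = f * w" using Suc.prems by (elim dvdE)
  have "poly ([:- a, 1:] ^ Suc n) a = 0" by simp
  then have "poly f a * poly w a = 0" by (simp only: w poly_mult)
  then have "poly w a = 0" using assms(1) by simp
  then obtain v where "w = [:- a, 1:] * v" by (metis dvd_def poly_eq_0_iff_dvd)
  then have "[:- a, 1:] * [:- a, 1:] ^ n = [:- a, 1:] * (f * v)"
    using w by (simp only: power_Suc ac_simps)
  then have "[:- a, 1:] ^ n = f * v" by (subst (asm) mult_cancel_left) auto
  then show ?case using Suc.IH by (metis dvd_triv_left)
qed

text \<open>Repeated squaring; the cross term is a double and vanishes in characteristic 2.\<close>

lemma linear_power_two_power_bit: "[:1, 1::bit:] ^ (2 ^ k) = monom 1 (2 ^ k) + 1"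
proof (induction k)
  case 0
  show ?case by (simp add: monom_altdef one_pCons)
next
  case (Suc k)
  have "[:1, 1::bit:] ^ (2 ^ Suc k) = (monom 1 (2 ^ k) + 1)\<^sup>2"
    by (simp add: power_mult[symmetric] Suc.IH[symmetric] mult.commute)
  also have "\<dots> = monom 1 (2 ^ Suc k) + 1 + (monom 1 (2 ^ k) + monom 1 (2 ^ k))"
    by (simp add: power2_eq_square algebra_simps mult_monom mult_2[symmetric])
  also have "monom 1 (2 ^ k) + monom 1 (2 ^ k) = (0 :: bit poly)"
    by (rule poly_eqI) (simp only: coeff_add coeff_0, simp)
  finally show ?case by simp
qed

lemma degree_monom_plus_1:
  "n > 0 \<Longrightarrow> degree (monom 1 n + 1 :: 'a::comm_semiring_1 poly) = n"
  by (subst degree_add_eq_left) (auto simp: degree_monom_eq)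

lemma of_int_bit_eq_0_iff: "(of_int a :: bit) = 0 \<longleftrightarrow> even a"
  by (cases "even a") (auto elim!: evenE oddE)

text \<open>Eisenstein's argument at the prime 2: modulo 2 the polynomial is a power of \<open>T + 1\<close>, while
  its value at 1 is 2 and hence not divisible by 4.\<close>

lemma prime_elem_two_power_cyclotomic:
  "prime_elem (monom 1 (2 ^ k) + 1 :: int poly)"
proof -
  let ?P = "monom 1 (2 ^ k) + 1 :: int poly"
  have lc: "lead_coeff ?P = 1" by (simp add: degree_monom_plus_1)
  have P1: "poly ?P 1 = 2" by (simp add: poly_monom)
  \<comment> \<open>Modulo 2 the factor \<open>f\<close> divides a power of \<open>T + 1\<close>
    without vanishing at its only root 1, so its reduction is constant. The leading coefficient of
    \<open>f\<close> divides 1 and survives the reduction, so \<open>f\<close> itself is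
    constant.\<close>
  have unit: "f dvd 1" if fg: "?P = f * g" and odd: "odd (poly f 1)" for f g :: "int poly"
  proof -
    let ?f = "map_poly of_int f :: bit poly"
    have "[:1, 1::bit:] ^ (2 ^ k) = ?f * map_poly of_int g"
      using arg_cong[OF fg, of "map_poly of_int :: _ \<Rightarrow> bit poly"]
      by (simp add: linear_power_two_power_bit hom_distribs)
    moreover have "poly ?f (of_int 1) = of_int (poly f 1)" by simp
    with odd have "poly ?f 1 \<noteq> 0" by (simp only: of_int_1 of_int_bit_eq_0_iff not_False_eq_True)
    ultimately have "degree ?f = 0"
      using dvd_linear_power_imp_degree_0[of ?f 1 "2 ^ k"] by simp
    have lcf: "lead_coeff f * lead_coeff g = 1" using lc fg by (metis lead_coeff_mult)
    then have "odd (lead_coeff f)" by (metis dvd_mult2 odd_one)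
    then have "coeff ?f (degree f) \<noteq> 0"
      by (simp only: of_int_hom.coeff_map_poly_hom of_int_bit_eq_0_iff not_False_eq_True)
    with \<open>degree ?f = 0\<close> have "degree f = 0" by (metis le_degree le_zero_eq)
    then obtain c where "f = [:c:]" by (rule degree_eq_zeroE)
    with lcf have "f * [:lead_coeff g:] = 1" by (simp add: one_pCons mult.commute)
    then show ?thesis by (metis dvd_triv_left)
  qed
  have "irreducible ?P"
  proof (rule irreducibleI)
    show "?P \<noteq> 0" using P1 by (metis poly_0 zero_neq_numeral)
    show "\<not> ?P dvd 1"
    proof
      assume "?P dvd 1"
      then obtain w where "1 = ?P * w" by (elim dvdE)
      then have "poly 1 1 = poly ?P 1 * poly w 1" by (metis poly_mult)
      then have "1 = 2 * poly w 1" by (simp only: P1 poly_1)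
      then show False by presburger
    qed
    fix f g assume fg: "?P = f * g"
    then have "poly f 1 * poly g 1 = 2" using P1 by (metis poly_mult)
    then have "\<not> (even (poly f 1) \<and> even (poly g 1))"
      using mult_dvd_mono[of 2 "poly f 1" 2 "poly g 1"] by auto
    then show "f dvd 1 \<or> g dvd 1" using unit[of f g] unit[of g f] fg by (auto simp: mult.commute)
  qed
  then show ?thesis by (rule irreducible_imp_prime_elem)
qed

section \<open>Cyclic convolution of periodic functions\<close>

definition periodic :: "int \<Rightarrow> (int \<Rightarrow> 'a) \<Rightarrow> bool" where
  "periodic M f \<longleftrightarrow> (\<forall>i. f (i + M) = f i)"

text \<open>For \<open>M\<close>-periodic arguments this is the product in the integral group ring
  of the residues modulo \<open>M\<close>; functions on all integers spare the reduction of
  arguments.\<close>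

definition cconv :: "int \<Rightarrow> (int \<Rightarrow> int) \<Rightarrow> (int \<Rightarrow> int) \<Rightarrow> int \<Rightarrow> int" where
  "cconv M g h j = (\<Sum>i\<in>{0..<M}. g i * h (j - i))"

lemma periodicD: "periodic M f \<Longrightarrow> f (i + M) = f i"
  by (simp add: periodic_def)

lemma periodic_mult:
  assumes "periodic M f"
  shows "f (i + M * q) = f i"
proof (induction q arbitrary: i rule: int_induct[where k = 0])
  case base
  show ?case by simp
next
  case (step1 q)
  then show ?case using periodicD[OF assms, of "i + M * q"] by (simp add: algebra_simps)
next
  case (step2 q)
  then show ?case using periodicD[OF assms, of "i + M * (q - 1)"] by (simp add: algebra_simps)
qed

lemma periodic_cong:
  assumes "periodic M f" and "M dvd i - j"
  shows "f i = f j"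
proof -
  obtain q where "i - j = M * q" using assms(2) by (elim dvdE)
  then have "i = j + M * q" by simp
  then show ?thesis using periodic_mult[OF assms(1)] by simp
qed

lemma periodic_mod: "periodic M f \<Longrightarrow> f (i mod M) = f i"
  by (rule periodic_cong) (auto simp: mod_eq_dvd_iff[symmetric])

text \<open>The map sending \<open>i\<close> to \<open>c + u * i\<close> permutes the residues
  modulo \<open>M\<close>; \<open>u = 1\<close> yields translations and \<open>u = -1\<close>
  reflections.\<close>

lemma sum_periodic_reindex:
  fixes f :: "int \<Rightarrow> 'a::comm_monoid_add"
  assumes "periodic M f" "M > 0" and u: "u * u = 1"
  shows "(\<Sum>i\<in>{0..<M}. f (c + u * i)) = (\<Sum>i\<in>{0..<M}. f i)"
proof (rule sum.reindex_bij_witness[of _ "\<lambda>i. (u * (i - c)) mod M" "\<lambda>i. (c + u * i) mod M"])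
  have uu: "u * (u * x) = x" for x by (simp add: u mult.assoc[symmetric])
  fix i assume i: "i \<in> {0..<M}"
  show "u * ((c + u * i) mod M - c) mod M = i"
  proof -
    have "u * ((c + u * i) mod M - c) mod M = (u * (c + u * i - c)) mod M"
      by (metis mod_diff_left_eq mod_mult_right_eq)
    then show ?thesis using i by (simp add: uu)
  qed
  show "(c + u * (u * (i - c) mod M)) mod M = i"
  proof -
    have "(c + u * (u * (i - c) mod M)) mod M = (c + u * (u * (i - c))) mod M"
      by (metis mod_add_right_eq mod_mult_right_eq)
    then show ?thesis using i by (simp add: uu)
  qed
  show "f ((c + u * i) mod M) = f (c + u * i)" by (rule periodic_mod[OF assms(1)])
qed (use assms(2) in auto)

lemma sum_periodic_shift:
  fixes f :: "int \<Rightarrow> 'a::comm_monoid_add"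
  assumes "periodic M f" "M > 0"
  shows "(\<Sum>i\<in>{0..<M}. f (i + c)) = (\<Sum>i\<in>{0..<M}. f i)"
  using sum_periodic_reindex[OF assms, of 1 c] by (simp add: add.commute)

lemma sum_periodic_reflect:
  fixes f :: "int \<Rightarrow> 'a::comm_monoid_add"
  assumes "periodic M f" "M > 0"
  shows "(\<Sum>i\<in>{0..<M}. f (c - i)) = (\<Sum>i\<in>{0..<M}. f i)"
  using sum_periodic_reindex[OF assms, of "-1" c] by simp

lemma sum_periodic_mult:
  fixes f :: "int \<Rightarrow> int"
  assumes "periodic M f" "M > 0"
  shows "(\<Sum>i\<in>{0..<M * int c}. f i) = int c * (\<Sum>i\<in>{0..<M}. f i)"
proof (induction c)
  case 0
  show ?case by simp
next
  case (Suc c)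
  have "{0..<M * int (Suc c)} = {0..<M * int c} \<union> {M * int c..<M * int c + M}"
    using assms(2) by (auto simp: algebra_simps intro: order_trans add_nonneg_nonneg)
       (smt (verit, best) mult_nonneg_nonneg of_nat_0_le_iff)
  then have "(\<Sum>i\<in>{0..<M * int (Suc c)}. f i) =
      (\<Sum>i\<in>{0..<M * int c}. f i) + (\<Sum>i\<in>{M * int c..<M * int c + M}. f i)"
    by (simp add: sum.union_disjoint)
  also have "(\<Sum>i\<in>{M * int c..<M * int c + M}. f i) = (\<Sum>i\<in>{0..<M}. f i)"
    by (rule sum.reindex_bij_witness[of _ "\<lambda>i. i + M * int c" "\<lambda>i. i - M * int c"])
      (auto simp: periodic_mult[OF assms(1), of _ "- int c", simplified])
  finally show ?case using Suc.IH by (simp add: algebra_simps)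
qed

lemma cconv_periodic:
  assumes "periodic M h"
  shows "periodic M (cconv M g h)"
  using periodicD[OF assms, of "_ - _"] by (simp add: periodic_def cconv_def algebra_simps)

text \<open>The sum runs through \<open>c\<close> full periods of the summand. This carries the
  convolution equation between the modulus \<open>2 ^ \<alpha>\<close> and a smaller period.\<close>

lemma cconv_mult_modulus:
  assumes "periodic M g" "periodic M h" "M > 0"
  shows "cconv (M * int c) g h j = int c * cconv M g h j"
proof -
  have "periodic M (\<lambda>i. g i * h (j - i))"
    using assms periodic_mult[OF assms(2), of _ "-1"]
    by (simp add: periodic_def diff_diff_eq[symmetric])
  from sum_periodic_mult[OF this assms(3)] show ?thesis by (simp add: cconv_def)
qed

lemma cconv_commute:
  assumes "periodic M g" "periodic M h" "M > 0"
  shows "cconv M g h j = cconv M h g j"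
proof -
  have "periodic M (\<lambda>i. h i * g (j - i))"
    using assms periodic_mult[OF assms(1), of _ "-1"]
    by (simp add: periodic_def diff_diff_eq[symmetric])
  from sum_periodic_reflect[OF this assms(3), of j] show ?thesis
    by (simp add: cconv_def mult.commute)
qed

lemma cconv_reflect:
  assumes "periodic M g" "periodic M h" "M > 0"
  shows "cconv M (\<lambda>i. g (- i)) (\<lambda>i. h (- i)) j = cconv M g h (- j)"
proof -
  have "periodic M (\<lambda>i. g i * h (- j - i))"
    using assms periodic_mult[OF assms(2), of _ "-1"]
    by (simp add: periodic_def diff_diff_eq[symmetric])
  from sum_periodic_reflect[OF this assms(3), of 0] show ?thesis
    by (simp add: cconv_def)
qed

lemma cconv_add_left: "cconv M (\<lambda>i. g i + g' i) h j = cconv M g h j + cconv M g' h j"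
  and cconv_add_right: "cconv M h (\<lambda>i. g i + g' i) j = cconv M h g j + cconv M h g' j"
  and cconv_diff_right: "cconv M h (\<lambda>i. g i - g' i) j = cconv M h g j - cconv M h g' j"
  and cconv_scale_right: "cconv M h (\<lambda>i. c * g i) j = c * cconv M h g j"
  by (simp_all add: cconv_def algebra_simps sum.distrib sum_subtractf sum_distrib_left)

text \<open>Only the \<open>i\<close> congruent to \<open>j - a\<close> survives, so convolution
  with the indicator of the class of \<open>a\<close> is translation by \<open>a\<close>.\<close>

lemma cconv_delta:
  assumes "periodic M g" "M > 0"
  shows "cconv M g (\<lambda>i. of_bool (M dvd i - a)) j = g (j - a)"
proof -
  have "M dvd j - i - a \<longleftrightarrow> i = (j - a) mod M" if "i \<in> {0..<M}" for i
  proof -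
    have "M dvd j - i - a \<longleftrightarrow> (j - a) mod M = i mod M"
      by (simp add: mod_eq_dvd_iff algebra_simps)
    then show ?thesis using that by auto
  qed
  then have "cconv M g (\<lambda>i. of_bool (M dvd i - a)) j =
      (\<Sum>i\<in>{0..<M}. if i = (j - a) mod M then g i else 0)"
    unfolding cconv_def by (intro sum.cong) auto
  also have "\<dots> = g (j - a)" using assms by (simp add: periodic_mod)
  finally show ?thesis .
qed

text \<open>For symmetric \<open>K\<close> the value \<open>cconv M K K h\<close> is the
  autocorrelation at shift \<open>h\<close>, which is the mixed term when the square is expanded.
  The convolution of \<open>K\<close> with itself thus measures how far \<open>K\<close> is from
  having period \<open>h\<close>.\<close>

lemma sum_diff_shift_squares:
  assumes "periodic M K" "M > 0" and sym: "\<And>i. K (- i) = K i"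
  shows "(\<Sum>i\<in>{0..<M}. (K i - K (i - h))\<^sup>2) = 2 * (cconv M K K 0 - cconv M K K h)"
proof -
  have "periodic M (\<lambda>i. (K i)\<^sup>2)" using assms(1) by (simp add: periodic_def)
  from sum_periodic_shift[OF this assms(2), of "- h"]
  have 1: "(\<Sum>i\<in>{0..<M}. (K (i - h))\<^sup>2) = (\<Sum>i\<in>{0..<M}. (K i)\<^sup>2)" by simp
  have 2: "cconv M K K 0 = (\<Sum>i\<in>{0..<M}. (K i)\<^sup>2)"
    by (simp add: cconv_def sym power2_eq_square)
  have 3: "cconv M K K h = (\<Sum>i\<in>{0..<M}. K i * K (i - h))"
    unfolding cconv_def using sym by (metis minus_diff_eq)
  show ?thesis unfolding power2_diff 3
    by (simp add: sum.distrib sum_subtractf 1 2 sum_distrib_left[symmetric] mult.assoc)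
qed

section \<open>Residue polynomials modulo \<open>T^m + 1\<close>\<close>

definition residue_poly :: "int \<Rightarrow> (int \<Rightarrow> int) \<Rightarrow> int poly" where
  "residue_poly M g = (\<Sum>i\<in>{0..<M}. monom (g i) (nat i))"

text \<open>\<open>T^m + 1\<close> divides \<open>T^(2m) - 1\<close>, so exponents matter only
  modulo \<open>2 * m\<close>.\<close>

lemma cyclotomic_dvd_monom_mod:
  "(monom 1 m + 1 :: int poly) dvd monom c a - monom c (a mod (2 * m))"
proof -
  have "(monom 1 m + 1) dvd (monom 1 (2 * m) - 1 :: int poly)"
    by (rule dvdI[of _ _ "monom 1 m - 1"]) (simp add: algebra_simps mult_monom flip: mult_2)
  also have "monom 1 (2 * m) - 1 dvd monom 1 (2 * m) ^ (a div (2 * m)) - (1 :: int poly)"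
    by (metis dvd_triv_left power_diff_1_eq)
  finally have "(monom 1 m + 1) dvd
    monom c (a mod (2 * m)) * (monom 1 (2 * m) ^ (a div (2 * m)) - (1 :: int poly))"
    by (rule dvd_mult)
  then show ?thesis
    by (simp add: right_diff_distrib mult_monom monom_power)
qed

text \<open>Once exponents are reduced modulo \<open>2 * m\<close>, multiplying residue polynomials
  collects coefficients exactly as cyclic convolution does.\<close>

lemma cyclotomic_dvd_residue_poly_mult:
  assumes "periodic (2 * int m) g" "periodic (2 * int m) h" "m > 0"
  shows "(monom 1 m + 1) dvd
    residue_poly (2 * int m) g * residue_poly (2 * int m) h -
    residue_poly (2 * int m) (cconv (2 * int m) g h)"
proof -
  let ?M = "2 * int m"
  have shift: "(\<Sum>j\<in>{0..<?M}. monom (g i * h (j - i)) (nat j)) =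
      (\<Sum>j\<in>{0..<?M}. monom (g i * h j) (nat ((i + j) mod ?M)))" for i
  proof -
    \<comment> \<open>The exponent is written with \<open>j mod ?M\<close> to make the summand
      periodic in \<open>j\<close>; on the summation range it is just \<open>nat j\<close>.\<close>
    have "periodic ?M (\<lambda>j. monom (g i * h (j - i)) (nat (j mod ?M)))"
      using periodicD[OF assms(2), of "_ - i"] by (simp add: periodic_def algebra_simps)
    from sum_periodic_shift[OF this, of i] assms(3)
    show ?thesis by (simp add: add.commute)
  qed
  have "residue_poly ?M (cconv ?M g h) =
      (\<Sum>i\<in>{0..<?M}. \<Sum>j\<in>{0..<?M}. monom (g i * h (j - i)) (nat j))"
    unfolding residue_poly_def cconv_def
    by (subst sum.swap) (simp add: monom_hom.hom_sum)
  then have "residue_poly ?M g * residue_poly ?M h - residue_poly ?M (cconv ?M g h) =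
      (\<Sum>i\<in>{0..<?M}. \<Sum>j\<in>{0..<?M}. monom (g i * h j) (nat i + nat j) -
        monom (g i * h j) (nat ((i + j) mod ?M)))"
    by (simp add: residue_poly_def sum_product mult_monom shift sum_subtractf)
  also have "(monom 1 m + 1) dvd \<dots>"
  proof (intro dvd_sum)
    fix i j assume "i \<in> {0..<?M}" "j \<in> {0..<?M}"
    then have "nat ((i + j) mod ?M) = (nat i + nat j) mod (2 * m)"
      by (simp add: nat_mod_distrib nat_add_distrib nat_mult_distrib)
    then show "(monom 1 m + 1) dvd
        monom (g i * h j) (nat i + nat j) - monom (g i * h j) (nat ((i + j) mod ?M))"
      using cyclotomic_dvd_monom_mod by simp
  qed
  finally show ?thesis .
qed

text \<open>Modulo \<open>T^m + 1\<close> the monomial \<open>T^(i + m)\<close> becomes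
  \<open>- T^i\<close>, so the upper half of the coefficients is subtracted from the lower half. The
  remainder has degree below \<open>m\<close> and is divisible only if it is zero.\<close>

lemma cyclotomic_dvd_residue_poly_iff:
  assumes "periodic (2 * int m) g" "m > 0"
  shows "(monom 1 m + 1) dvd residue_poly (2 * int m) g \<longleftrightarrow> periodic (int m) g"
proof -
  let ?P = "monom 1 m + 1 :: int poly"
  let ?R = "\<Sum>i<m. monom (g (int i) - g (int i + int m)) i"
  have nat_sum: "residue_poly (2 * int m) g = (\<Sum>i<2 * m. monom (g (int i)) i)"
    unfolding residue_poly_def
    by (rule sum.reindex_bij_witness[of _ int nat]) auto
  have "(\<Sum>i<2 * m. monom (g (int i)) i) =
      (\<Sum>i<m. monom (g (int i)) i) + (\<Sum>i<m. monom (g (int i + int m)) (i + m))"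
    using sum.atLeastLessThan_concat[of 0 m "2 * m" "\<lambda>i. monom (g (int i)) i"]
      sum.shift_bounds_nat_ivl[of "\<lambda>i. monom (g (int i)) i" 0 m m]
    by (simp add: lessThan_atLeast0 mult_2)
  also have "\<dots> = ?R + ?P * (\<Sum>i<m. monom (g (int i + int m)) i)"
    by (simp add: distrib_right sum_distrib_left mult_monom sum.distrib sum_subtractf
        diff_monom[symmetric] add.commute[of m])
  finally have "?P dvd residue_poly (2 * int m) g \<longleftrightarrow> ?P dvd ?R"
    unfolding nat_sum by (simp add: dvd_add_left_iff)
  also have "\<dots> \<longleftrightarrow> ?R = 0"
  proof
    assume dvd: "?P dvd ?R"
    show "?R = 0"
    proof (rule ccontr)
      assume "?R \<noteq> 0"
      then have "m \<le> degree ?R"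
        using dvd_imp_degree_le[OF dvd] by (simp add: degree_monom_plus_1 assms(2))
      moreover have "degree ?R < m"
        by (rule degree_sum_less) (use assms(2) in \<open>auto intro: le_less_trans[OF degree_monom_le]\<close>)
      ultimately show False by simp
    qed
  qed simp
  also have "\<dots> \<longleftrightarrow> (\<forall>i<m. g (int i + int m) = g (int i))"
    by (auto simp: poly_eq_iff coeff_sum)
  also have "\<dots> \<longleftrightarrow> periodic (int m) g"
  proof
    assume *: "\<forall>i<m. g (int i + int m) = g (int i)"
    have **: "g (i + int m) = g i" if "0 \<le> i" "i < 2 * int m" for i
    proof (cases "i < int m")
      case True
      then show ?thesis using *[rule_format, of "nat i"] that by simp
    next
      case False
      then show ?thesis
        using *[rule_format, of "nat (i - int m)"] that periodicD[OF assms(1), of "i - int m"]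
        by (simp add: algebra_simps)
    qed
    show "periodic (int m) g" unfolding periodic_def
    proof
      fix i
      have "g (i + int m) = g (i mod (2 * int m) + int m)"
        by (rule periodic_cong[OF assms(1)]) (simp add: mod_eq_dvd_iff[symmetric])
      then show "g (i + int m) = g i"
        using **[of "i mod (2 * int m)"] assms(2) by (simp add: periodic_mod[OF assms(1)])
    qed
  qed (simp add: periodic_def)
  finally show ?thesis .
qed

text \<open>Period \<open>m\<close> means that \<open>T^m + 1\<close> divides the residue
  polynomial, and this polynomial is prime because \<open>m\<close> is a power of two.\<close>

lemma cconv_half_periodic_cases:
  assumes "m = 2 ^ k" "periodic (2 * int m) g" "periodic (2 * int m) h"
    and "periodic (int m) (cconv (2 * int m) g h)"
  shows "periodic (int m) g \<or> periodic (int m) h"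
proof -
  let ?P = "monom 1 m + 1 :: int poly"
  have m: "m > 0" using assms(1) by simp
  have "periodic (2 * int m) (cconv (2 * int m) g h)"
    using periodic_mult[OF assms(4), of _ 2] by (simp add: periodic_def mult.commute)
  then have "?P dvd residue_poly (2 * int m) (cconv (2 * int m) g h)"
    using cyclotomic_dvd_residue_poly_iff[OF _ m] assms(4) by blast
  then have "?P dvd residue_poly (2 * int m) g * residue_poly (2 * int m) h"
    using cyclotomic_dvd_residue_poly_mult[OF assms(2,3) m] by (metis diff_add_cancel dvd_add)
  then have "?P dvd residue_poly (2 * int m) g \<or> ?P dvd residue_poly (2 * int m) h"
    using prime_elem_two_power_cyclotomic[of k] assms(1) by (simp add: prime_elem_dvd_mult_iff)
  then show ?thesis
    using cyclotomic_dvd_residue_poly_iff[OF assms(2) m]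
      cyclotomic_dvd_residue_poly_iff[OF assms(3) m] by simp
qed

section \<open>Indicator functions\<close>

lemma periodic_indicator_dvd: "periodic M (\<lambda>i. of_bool (M dvd i - a))"
  by (simp add: periodic_def diff_add_eq[symmetric])

lemma cconv_const_right: "cconv M g (\<lambda>_. c) j = c * (\<Sum>i\<in>{0..<M}. g i)"
  by (simp add: cconv_def sum_distrib_left mult.commute)

definition symmetrization :: "(int \<Rightarrow> int) \<Rightarrow> int \<Rightarrow> int" where
  "symmetrization x i = x i + x (- i)"

locale periodic_indicator =
  fixes M :: int and x :: "int \<Rightarrow> int"
  assumes M_pos: "M > 0"
    and x_periodic: "periodic M x"
    and x_01: "x i = 0 \<or> x i = 1"
    and x_0: "x 0 = 0"
begin

abbreviation F :: "int \<Rightarrow> int" where "F \<equiv> symmetrization x"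

lemma F_sym: "F (- i) = F i"
  by (simp add: symmetrization_def)

lemma F_0: "F 0 = 0"
  by (simp add: symmetrization_def x_0)

lemma x_reflect_periodic: "periodic M (\<lambda>i. x (- i))"
  using periodic_mult[OF x_periodic, of _ "-1"] by (simp add: periodic_def)

lemma F_periodic: "periodic M F"
  using x_periodic x_reflect_periodic by (simp add: periodic_def symmetrization_def)

lemma sum_F: "(\<Sum>i\<in>{0..<M}. F i) = 2 * (\<Sum>i\<in>{0..<M}. x i)"
  using sum_periodic_reflect[OF x_periodic M_pos, of 0]
  by (simp add: symmetrization_def sum.distrib)

text \<open>Reflecting \<open>x\<close> reflects its convolution with a symmetric function. This
  turns equations for convolutions with \<open>x\<close> into equations for convolutions with
  \<open>F\<close>.\<close>

lemma cconv_F: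
  assumes "periodic M K" "\<And>i. K (- i) = K i"
  shows "cconv M F K j = cconv M x K j + cconv M x K (- j)"
  using cconv_reflect[OF x_periodic assms(1) M_pos, of j]
  by (simp add: symmetrization_def[abs_def] cconv_add_left assms(2))

end

section \<open>The convolution equation at the least 2-power period\<close>

locale half_aperiodic = periodic_indicator +
  fixes m k :: nat and \<delta> \<mu> :: int
  assumes m: "m = 2 ^ k" and M: "M = 2 * int m"
    and aperiodic: "\<not> periodic (int m) x"
    and conv: "cconv M x F j = \<delta> * x j + \<mu>"
    and genuine: "\<mu> < 2 * (\<Sum>i\<in>{0..<M}. x i)"
begin

lemma m_pos: "m > 0"
  by (simp add: m)

text \<open>By \<open>conv\<close>, the function \<open>F\<close> minus \<open>\<delta>\<close>
  times the indicator of the multiples of \<open>M\<close> has constant convolution with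
  \<open>x\<close>. Since \<open>x\<close> lacks the period \<open>m\<close>, that difference has
  it.\<close>

lemma F_jump:
  "F (j + int m) - F j = \<delta> * (of_bool (M dvd j + int m) - of_bool (M dvd j))"
proof -
  define h where "h j = F j - \<delta> * of_bool (M dvd j - 0)" for j
  have per: "periodic M h"
    using F_periodic periodic_indicator_dvd[of M 0] by (simp add: periodic_def h_def)
  have "cconv M x h j = \<mu>" for j
    using cconv_delta[OF x_periodic M_pos, of 0 j]
    unfolding h_def by (simp add: cconv_diff_right cconv_scale_right conv)
  then have "periodic (int m) (cconv M x h)" by (simp add: periodic_def)
  then have "periodic (int m) h"
    using cconv_half_periodic_cases[OF m] x_periodic per aperiodic M by blast
  then have "h (j + int m) = h j" by (rule periodicD)
  then show ?thesis by (simp add: h_def algebra_simps)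
qed

lemma x_nonzero: "\<exists>i. x i = 1"
  using aperiodic x_01 by (metis periodic_def)

lemma half_notin: "\<not> M dvd int m"
  using m_pos unfolding M by (auto dest: zdvd_imp_le)

text \<open>Since \<open>int m\<close> is its own negative modulo \<open>M\<close>, the jump of
  \<open>F\<close> from 0 to \<open>int m\<close> gives \<open>2 * x (int m) = - \<delta>\<close>;
  it remains to exclude the value 0.\<close>

lemma x_half: "x (int m) = 1" and delta: "\<delta> = - 2"
proof -
  have "x (- int m) = x (int m)"
    by (rule periodic_cong[OF x_periodic]) (auto simp: M dvd_def intro: exI[of _ "- 1"])
  then have F: "F (int m) = 2 * x (int m)" by (simp add: symmetrization_def)
  then have d: "2 * x (int m) = - \<delta>"
    using F_jump[of 0] half_notin by (simp add: F_0)
  show x_half: "x (int m) = 1"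
  proof (rule ccontr)
    assume "x (int m) \<noteq> 1"
    then have "\<delta> = 0" using d x_01[of "int m"] by auto
    obtain i where i: "x i = 1" using x_nonzero by blast
    \<comment> \<open>With \<open>\<delta> = 0\<close> the convolution of \<open>F\<close> with
      itself is constant, so \<open>F\<close> is invariant under the shift by \<open>i\<close>. Then
      \<open>F (- i) = F 0 = 0\<close>, although \<open>x i = 1\<close>.\<close>
    have "(\<Sum>j\<in>{0..<M}. (F j - F (j - i))\<^sup>2) = 0"
      using sum_diff_shift_squares[OF F_periodic M_pos F_sym]
      by (simp add: cconv_F[OF F_periodic F_sym] conv \<open>\<delta> = 0\<close>)
    then have "F 0 = F (0 - i)"
      using M_pos by (simp add: sum_nonneg_eq_0_iff)
    then show False using i x_01[of "- i"] by (auto simp: symmetrization_def x_0)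
  qed
  then show "\<delta> = - 2" using d by simp
qed

text \<open>The condition \<open>M dvd j + int m\<close> says that \<open>j\<close> is congruent to
  \<open>m\<close> modulo \<open>M\<close>. The correction levels the values 0 and 2 of
  \<open>F\<close> at 0 and \<open>int m\<close> to 1.\<close>

definition K :: "int \<Rightarrow> int" where
  "K j = F j + of_bool (M dvd j) - of_bool (M dvd j + int m)"

lemma dvd_minus_half: "M dvd j - int m \<longleftrightarrow> M dvd j + int m"
proof -
  have "j + int m = (j - int m) + M" by (simp add: M)
  then show ?thesis by (metis dvd_add_triv_right_iff)
qed

lemma K_half_periodic: "periodic (int m) K"
  unfolding periodic_def
proof
  fix j
  have "j + int m + int m = j + M" by (simp add: M)
  then have "M dvd j + int m + int m \<longleftrightarrow> M dvd j" by simp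
  then show "K (j + int m) = K j"
    using F_jump[of j] by (simp add: K_def delta)
qed

lemma K_periodic: "periodic M K"
  using periodic_mult[OF K_half_periodic, of _ 2] by (simp add: periodic_def M mult.commute)

lemma K_sym: "K (- j) = K j"
proof -
  have "M dvd - j + int m \<longleftrightarrow> M dvd j - int m"
    by (metis dvd_minus_iff minus_diff_eq uminus_add_conv_diff)
  then show ?thesis by (simp add: K_def F_sym dvd_minus_half)
qed

lemma K_0: "K 0 = 1"
  by (simp add: K_def F_0 half_notin)

lemma cconv_K:
  assumes "periodic M g"
  shows "cconv M g K j = cconv M g F j + g j - g (j + int m)"
proof -
  have K: "K = (\<lambda>j. F j + of_bool (M dvd j - 0) - of_bool (M dvd j - int m))"
    by (simp add: fun_eq_iff K_def dvd_minus_half)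
  have "g (j - int m) = g (j + int m)"
    by (rule periodic_cong[OF assms]) (simp add: M)
  then show ?thesis
    unfolding K by (simp only: cconv_diff_right cconv_add_right cconv_delta[OF assms M_pos]) simp
qed

lemma F_add_half: "F j + F (j + int m) = 2 * K j"
proof -
  have "j + int m + int m = j + M" by (simp add: M)
  then have "M dvd j + int m + int m \<longleftrightarrow> M dvd j" by simp
  then show ?thesis
    using periodicD[OF K_half_periodic, of j] by (simp add: K_def)
qed

lemma cconv_x_K: "cconv M x K j = \<mu> - x j - x (j + int m)"
  by (simp add: cconv_K[OF x_periodic] conv delta)

text \<open>Symmetrizing \<open>cconv_x_K\<close> gives the convolution of \<open>F\<close> with
  \<open>K\<close>. Replacing \<open>F\<close> by \<open>K\<close> changes nothing, because the two
  corrections contribute \<open>K j - K (j + int m) = 0\<close>.\<close>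

lemma cconv_K_K: "cconv M K K j = 2 * \<mu> - 2 * K j"
proof -
  have "x (- j + int m) = x (- (j + int m))"
    by (rule periodic_cong[OF x_periodic]) (simp add: M)
  then have "cconv M F K j = 2 * \<mu> - (F j + F (j + int m))"
    by (simp add: cconv_F[OF K_periodic K_sym] cconv_x_K symmetrization_def)
  then show ?thesis
    using cconv_commute[OF K_periodic F_periodic M_pos, of j] periodicD[OF K_half_periodic]
    by (simp add: cconv_K[OF K_periodic] F_add_half)
qed

text \<open>Over a full period \<open>M\<close> the sum is twice the drop of the self-convolution of
  \<open>K\<close> from 0 to \<open>h\<close>, that is \<open>4 * (K h - 1)\<close>; the summand has
  period \<open>m\<close>, which halves it.\<close>

lemma K_squares: "(\<Sum>i\<in>{0..<int m}. (K i - K (i - h))\<^sup>2) = 2 * (K h - 1)"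
proof -
  have "periodic (int m) (\<lambda>i. (K i - K (i - h))\<^sup>2)"
    using periodicD[OF K_half_periodic] periodicD[OF K_half_periodic, of "_ - h"]
    by (simp add: periodic_def algebra_simps)
  from sum_periodic_mult[OF this, of 2] m_pos
  have "2 * (\<Sum>i\<in>{0..<int m}. (K i - K (i - h))\<^sup>2) = (\<Sum>i\<in>{0..<M}. (K i - K (i - h))\<^sup>2)"
    by (simp add: M mult.commute)
  also have "\<dots> = 4 * (K h - 1)"
    by (simp add: sum_diff_shift_squares[OF K_periodic M_pos K_sym] cconv_K_K K_0)
  finally show ?thesis by simp
qed

lemma K_ge_1: "K h \<ge> 1"
  using K_squares[of h] sum_nonneg[of "{0..<int m}" "\<lambda>i. (K i - K (i - h))\<^sup>2"] by simp

lemma K_le_2: "K h \<le> 2"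
proof (cases "int m dvd h")
  case True
  then show ?thesis using periodic_cong[OF K_half_periodic, of h 0] K_0 by simp
next
  case False
  then have "\<not> M dvd h" unfolding M by (metis dvd_mult_right)
  then show ?thesis
    using x_01[of h] x_01[of "- h"] by (auto simp: K_def symmetrization_def)
qed

text \<open>The periods of \<open>K\<close> are the places where \<open>K\<close> is 1, and shifting by a place where
  \<open>K\<close> is 2 changes only two values modulo \<open>m\<close>.\<close>

lemma K_dichotomy: "(\<forall>j. K j = 1) \<or> (\<forall>j. \<not> int m dvd j \<longrightarrow> K j = 2)"
proof (rule ccontr)
  assume "\<not> ?thesis"
  then obtain h l where h: "K h \<noteq> 1" and l: "\<not> int m dvd l" "K l \<noteq> 2" by blast
  have h2: "K h = 2" and l1: "K l = 1"
    using h l K_ge_1[of h] K_le_2[of h] K_ge_1[of l] K_le_2[of l] by auto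
  have sq0: "(\<Sum>i\<in>{0..<int m}. (K i - K (i - l))\<^sup>2) = 0" using K_squares[of l] l1 by simp
  have Kmod: "K (i mod int m) = K i" "K (i mod int m - h) = K (i - h)"
    "K (i mod int m - l) = K (i - l)" for i
    using periodic_mod[OF K_half_periodic]
    by (auto intro!: periodic_cong[OF K_half_periodic] simp: mod_eq_dvd_iff[symmetric] mod_simps)
  have per: "K i = K (i - l)" for i
  proof -
    have "(K (i mod int m) - K (i mod int m - l))\<^sup>2 = 0"
      using sq0 m_pos by (subst (asm) sum_nonneg_eq_0_iff) auto
    then show ?thesis by (simp add: Kmod)
  qed
  let ?f = "\<lambda>i. (K i - K (i - h))\<^sup>2"
  \<comment> \<open>At 0, \<open>h\<close> and \<open>l\<close> the values of \<open>K\<close> and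
    of its shift by \<open>h\<close> are 1 and 2 in some order, which already gives 3, while
    \<open>K_squares\<close> allows only 2.\<close>
  let ?A = "{0, h mod int m, l mod int m}"
  have ne: "0 \<noteq> h mod int m" "0 \<noteq> l mod int m" "h mod int m \<noteq> l mod int m"
    using l(1) Kmod(1)[of h] Kmod(1)[of l] h2 l1 K_0 by (auto simp: dvd_eq_mod_eq_0)
  have "K (l - h) = 2"
    using per[of "l - h"] K_sym[of h] h2 by simp
  then have "sum ?f ?A = 3"
    using ne Kmod K_0 K_sym[of h] h2 l1 by simp
  moreover have "sum ?f ?A \<le> sum ?f {0..<int m}"
    by (rule sum_mono2) (use m_pos in auto)
  ultimately show False using K_squares[of h] h2 by simp
qed

text \<open>In the other case of \<open>K_dichotomy\<close>, \<open>x\<close> is 1 off the multiples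
  of \<open>M\<close>. Then \<open>conv\<close> at 0 makes \<open>\<mu>\<close> the sum of
  \<open>F\<close>, twice the sum of \<open>x\<close>, against \<open>genuine\<close>.\<close>

lemma K_eq_1: "K j = 1"
proof (rule ccontr)
  assume "K j \<noteq> 1"
  then have two: "\<not> int m dvd i \<Longrightarrow> K i = 2" for i using K_dichotomy by blast
  have "x i * F i = F i" for i
  proof (cases "M dvd i")
    case True
    then have "F i = 0" using periodic_cong[OF F_periodic, of i 0] F_0 by simp
    then show ?thesis by simp
  next
    case False
    have "x i = 1"
    proof (cases "int m dvd i")
      case True
      then obtain q where q: "i = int m * q" by (elim dvdE)
      have "odd q"
      proof
        assume "even q"
        then have "M dvd i" by (auto simp: q M elim!: evenE)
        then show False using False by simp
      qed
      then obtain r where r: "q = 2 * r + 1" by (elim oddE)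
      have "i - int m = M * r" unfolding q r M by (simp add: algebra_simps)
      then have "M dvd i - int m" by simp
      then show ?thesis using periodic_cong[OF x_periodic, of i "int m"] x_half by simp
    next
      case nd: False
      then have "\<not> M dvd i + int m" unfolding M
        using dvd_mult_right[of 2 "int m" "i + int m"] by auto
      then have "F i = 2" using two[OF nd] False by (simp add: K_def)
      then show ?thesis using x_01[of i] x_01[of "- i"] by (auto simp: symmetrization_def)
    qed
    then show ?thesis by simp
  qed
  then have "\<mu> = (\<Sum>i\<in>{0..<M}. F i)"
    using conv[of 0] by (simp only: cconv_def F_sym x_0 diff_0)
  then show False using genuine sum_F by simp
qed

text \<open>With \<open>K\<close> constantly 1, its convolution with \<open>x\<close> is constant,
  so by \<open>cconv_x_K\<close> the left side is independent of \<open>j\<close>; at 0 it is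
  \<open>x 0 + x (int m) = 1\<close>.\<close>

lemma x_add_half: "x j + x (j + int m) = 1"
proof -
  have "K = (\<lambda>_. 1)" by (simp add: K_eq_1 fun_eq_iff)
  then have "(\<Sum>i\<in>{0..<M}. x i) = \<mu> - x j - x (j + int m)" for j
    using cconv_x_K[of j] by (simp add: cconv_const_right)
  from this[of 0] this[of j] show ?thesis using x_0 x_half by simp
qed

lemma F_eq: "F j = 1 - of_bool (M dvd j) + of_bool (M dvd j + int m)"
  using K_eq_1[of j] by (simp add: K_def)

text \<open>For \<open>M = 2\<close> the equation at 0 gives \<open>\<mu> = F (-1) = 2\<close>,
  twice the sum of \<open>x\<close>, against \<open>genuine\<close>. This yields the bound
  \<open>2 \<le> \<gamma>\<close>.\<close>

lemma k_pos: "k > 0"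
proof (rule ccontr)
  assume "\<not> k > 0"
  then have [simp]: "m = 1" by (simp add: m)
  have "{0..<M} = {0, 1}" by (auto simp: M)
  then show False
    using genuine conv[of 0] x_half F_eq[of "-1"] x_0 by (simp add: cconv_def M)
qed

end

section \<open>Dihedrants\<close>

text \<open>The exponent of \<open>x\<close> in the normal form of \<open>u\<^sup>-\<^sup>1 v\<close>.\<close>

definition dih_diff :: "int \<times> bool \<Rightarrow> int \<times> bool \<Rightarrow> int" where
  "dih_diff u v = (if snd u then fst u - fst v else fst v - fst u)"

lemma pverts_Dih: "n > 0 \<Longrightarrow> pverts (Dih n X Y) = {0..<int n} \<times> UNIV"
  by (simp add: Dih_def cayley_digraph_def carrier_dihedral_group carrier_integer_mod_group)

text \<open>Rotations and reflections use the same \<open>X\<close>, so the connection set is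
  \<open>X \<times> UNIV\<close> and only the exponent of the quotient matters.\<close>

lemma parcs_Dih:
  assumes "n > 0" "X \<subseteq> {0..<int n}"
  shows "(u, v) \<in> parcs (Dih n X X) \<longleftrightarrow>
    u \<in> {0..<int n} \<times> UNIV \<and> v \<in> {0..<int n} \<times> UNIV \<and> dih_diff u v mod int n \<in> X"
proof -
  have [simp]: "i mod int n = i" if "i \<in> X" for i using that assms(2) by auto
  have "{dih_x n [^]\<^bsub>dihedral_group n\<^esub> i |i. i \<in> X} \<union>
      {dih_x n [^]\<^bsub>dihedral_group n\<^esub> j \<otimes>\<^bsub>dihedral_group n\<^esub> dih_a n |j. j \<in> X} = X \<times> UNIV"
    by (force simp: dih_x_int_pow dih_a_def mult_dihedral_group)
  moreover have "inv\<^bsub>dihedral_group n\<^esub> u \<otimes>\<^bsub>dihedral_group n\<^esub> v =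
      (dih_diff u v mod int n, snd u \<noteq> snd v)"
    if "u \<in> carrier (dihedral_group n)" "v \<in> carrier (dihedral_group n)"
    using that
    by (cases u; cases v)
      (auto simp: carrier_dihedral_group inv_dihedral_group mult_dihedral_group dih_diff_def
        mod_simps)
  ultimately show ?thesis using assms(1)
    by (auto simp: Dih_def cayley_digraph_def carrier_dihedral_group carrier_integer_mod_group)
qed

lemma sum_dihedral:
  "(\<Sum>w\<in>A \<times> (UNIV :: bool set). f w) = (\<Sum>k\<in>A. f (k, False) + f (k, True))"
  using sum.cartesian_product[of "\<lambda>k e. f (k, e)" UNIV A]
  by (simp add: UNIV_bool add.commute)

text \<open>Adjacency is \<open>x\<close> at \<open>dih_diff u v\<close>, and the squared matrix is
  the convolution of \<open>x\<close> with its symmetrization at the same place, so the matrix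
  equation becomes one on the integers.\<close>

lemma is_dsrg_Dih_iff:
  assumes "n > 0" and X: "X \<subseteq> {0..<int n} - {0}"
    and x: "\<And>i. x i = of_bool (i mod int n \<in> X)"
  shows "is_dsrg (Dih n X X) \<longleftrightarrow>
    (\<exists>l t :: nat. 0 < t \<and> int t < 2 * (\<Sum>i\<in>{0..<int n}. x i) \<and>
      (\<forall>j. cconv (int n) x (symmetrization x) j = (int l - int t) * x j + int t))"
    (is "_ \<longleftrightarrow> ?rhs")
proof -
  interpret periodic_indicator "int n" x
    using assms(1) X by unfold_locales (auto simp: x periodic_def)
  let ?G = "Dih n X X" and ?V = "{0..<int n} \<times> (UNIV :: bool set)"
  let ?a = "\<lambda>u v. if (u, v) \<in> parcs ?G then 1 else (0::int)"
  let ?s = "\<Sum>i\<in>{0..<int n}. x i"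
  have V: "pverts ?G = ?V" using assms(1) by (rule pverts_Dih)
  have cardV: "card ?V = 2 * n" by (simp add: card_cartesian_product)
  have a: "?a u v = x (dih_diff u v)" if "u \<in> ?V" "v \<in> ?V" for u v
    using parcs_Dih[OF assms(1), of X u v] X that by (auto simp: x)
  note shift = sum_periodic_shift[OF x_periodic M_pos]
    and reflect = sum_periodic_reflect[OF x_periodic M_pos]
  have row: "(\<Sum>w\<in>?V. ?a u w) = 2 * ?s" if "u \<in> ?V" for u
  proof -
    have "(\<Sum>w\<in>?V. ?a u w) = (\<Sum>w\<in>?V. x (dih_diff u w))"
      using that by (intro sum.cong refl a)
    then show ?thesis
      using shift[of "- fst u"] reflect[of "fst u"]
      by (cases "snd u") (simp_all add: sum_dihedral dih_diff_def sum_distrib_left[symmetric])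
  qed
  have col: "(\<Sum>w\<in>?V. ?a w v) = 2 * ?s" if "v \<in> ?V" for v
  proof -
    have "(\<Sum>w\<in>?V. ?a w v) = (\<Sum>w\<in>?V. x (dih_diff w v))"
      using that by (intro sum.cong refl a)
    then show ?thesis
      using shift[of "- fst v"] reflect[of "fst v"]
      by (simp add: sum_dihedral dih_diff_def sum.distrib)
  qed
  have square: "(\<Sum>w\<in>?V. ?a u w * ?a w v) = cconv (int n) x F (dih_diff u v)"
    if "u \<in> ?V" "v \<in> ?V" for u v
  proof -
    obtain i e j f where uv: "u = (i, e)" "v = (j, f)" by (cases u; cases v)
    have "(\<Sum>w\<in>?V. ?a u w * ?a w v) = (\<Sum>w\<in>?V. x (dih_diff u w) * x (dih_diff w v))"
      using that by (intro sum.cong refl arg_cong2[where f = "(*)"] a)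
    \<comment> \<open>The first factor ignores the reflection bit of \<open>w\<close>; summing the
      second over both bits gives \<open>x (j - k) + x (k - j)\<close>.\<close>
    also have "\<dots> = (\<Sum>k\<in>{0..<int n}. x (if e then i - k else k - i) * F (j - k))"
      by (cases e) (simp_all add: sum_dihedral dih_diff_def uv symmetrization_def algebra_simps)
    also have "\<dots> = cconv (int n) x F (dih_diff u v)"
    proof (cases e)
      case False
      have "periodic (int n) (\<lambda>k. x (k - i) * F (j - k))"
        unfolding periodic_def
        by (intro allI arg_cong2[where f = "(*)"] periodic_cong[OF x_periodic]
            periodic_cong[OF F_periodic]) simp_all
      from sum_periodic_shift[OF this M_pos, of i] False show ?thesis
        by (simp add: cconv_def uv dih_diff_def algebra_simps)
    next
      case True
      have "periodic (int n) (\<lambda>k. x (i - k) * F (j - k))"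
        unfolding periodic_def
        by (intro allI arg_cong2[where f = "(*)"] periodic_cong[OF x_periodic]
            periodic_cong[OF F_periodic]) simp_all
      moreover have "F (j - (i - k)) = F (i - j - k)" for k
        using F_sym[of "i - j - k"] by (simp add: algebra_simps)
      ultimately show ?thesis
        using sum_periodic_reflect[OF _ M_pos, of "\<lambda>k. x (i - k) * F (j - k)" i] True
        by (simp add: cconv_def uv dih_diff_def)
    qed
    finally show ?thesis .
  qed
  have cconv_mod: "cconv (int n) x F (j mod int n) = cconv (int n) x F j" for j
    by (rule periodic_mod[OF cconv_periodic[OF F_periodic]])
  have matrix: "(\<forall>u\<in>?V. (\<Sum>w\<in>?V. ?a u w) = int k) \<and> (\<forall>v\<in>?V. (\<Sum>w\<in>?V. ?a w v) = int k) \<and>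
    (\<forall>u\<in>?V. \<forall>v\<in>?V. (\<Sum>w\<in>?V. ?a u w * ?a w v) =
      (if u = v then int t else 0) + int l * ?a u v +
      int \<mu> * (1 - (if u = v then 1 else 0) - ?a u v)) \<longleftrightarrow>
    int k = 2 * ?s \<and> t = \<mu> \<and> (\<forall>j. cconv (int n) x F j = (int l - int t) * x j + int t)"
    (is "?L \<longleftrightarrow> ?R") for k t l \<mu>
  proof
    assume L: ?L
    have o: "(0, e) \<in> ?V" for e using assms(1) by auto
    have k: "int k = 2 * ?s"
      using bspec[OF conjunct1[OF L] o[of False]] row[OF o[of False]] by (rule trans[OF sym])
    have prod: "cconv (int n) x F (dih_diff u v) =
      (if u = v then int t else 0) + int l * x (dih_diff u v) +
      int \<mu> * (1 - (if u = v then 1 else 0) - x (dih_diff u v))" if "u \<in> ?V" "v \<in> ?V" for u v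
    proof -
      have "(\<Sum>w\<in>?V. ?a u w * ?a w v) =
        (if u = v then int t else 0) + int l * ?a u v +
        int \<mu> * (1 - (if u = v then 1 else 0) - ?a u v)" using L that by blast
      then show ?thesis unfolding a[OF that] square[OF that] .
    qed
    \<comment> \<open>The vertices \<open>(0, False)\<close> and \<open>(0, True)\<close> both have
      difference 0 from the first of them. With \<open>x 0 = 0\<close> the diagonal entry is
      \<open>t\<close> and the other is \<open>\<mu>\<close>.\<close>
    have t: "t = \<mu>"
      using prod[OF o[of False] o[of False]] prod[OF o[of False] o[of True]]
      by (simp add: dih_diff_def x_0)
    have "cconv (int n) x F j = (int l - int t) * x j + int t" for j
    proof -
      have "(j mod int n, True) \<in> ?V" using assms(1) by auto
      from prod[OF o[of False] this] show ?thesis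
        by (simp add: dih_diff_def cconv_mod periodic_mod[OF x_periodic] t algebra_simps)
    qed
    with k t show ?R by blast
  next
    assume R: ?R
    have "(\<Sum>w\<in>?V. ?a u w * ?a w v) =
        (if u = v then int t else 0) + int l * ?a u v +
        int \<mu> * (1 - (if u = v then 1 else 0) - ?a u v)" if "u \<in> ?V" "v \<in> ?V" for u v
      unfolding a[OF that] square[OF that] using R by (auto simp: algebra_simps)
    moreover have "(\<Sum>w\<in>?V. ?a u w) = int k" "(\<Sum>w\<in>?V. ?a w u) = int k" if "u \<in> ?V" for u
      using R row[OF that] col[OF that] by (simp_all only:)
    ultimately show ?L by blast
  qed
  have digraph: "pair_digraph ?G"
  proof
    show "e \<in> parcs ?G \<Longrightarrow> fst e \<in> pverts ?G" "e \<in> parcs ?G \<Longrightarrow> snd e \<in> pverts ?G" for e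
      using parcs_Dih[OF assms(1), of X "fst e" "snd e"] X by (auto simp: V)
    have "X \<subseteq> {0..<int n}" using X by blast
    then have "parcs ?G \<subseteq> ?V \<times> ?V"
      using parcs_Dih[OF assms(1)] by (intro subrelI SigmaI) blast+
    then show "finite (parcs ?G)" by (rule finite_subset) simp
    show "finite (pverts ?G)" by (simp add: V)
    show "fst e \<noteq> snd e" if "e \<in> parcs ?G" for e
    proof
      assume "fst e = snd e"
      then have "dih_diff (fst e) (snd e) = 0" by (simp add: dih_diff_def)
      then show False
        using that parcs_Dih[OF assms(1), of X "fst e" "snd e"] X by auto
    qed
  qed
  obtain ws where ws: "distinct ws" "set ws = ?V"
    using finite_distinct_list[of ?V] by auto
  have dsrg: "dsrg ?G N k \<mu> l t \<longleftrightarrow> N = 2 * n \<and> 0 < t \<and> t < k \<and> int k = 2 * ?s \<and> t = \<mu> \<and>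
    (\<forall>j. cconv (int n) x F j = (int l - int t) * x j + int t)" (is "_ \<longleftrightarrow> ?R") for N k \<mu> l t
  proof
    assume d: "dsrg ?G N k \<mu> l t"
    then have N: "card ?V = N" "0 < t" "t < k" by (simp_all add: dsrg_def V)
    have "set ws = pverts ?G" by (simp add: V ws)
    from dsrg_any_enumeration[OF d ws(1) this, 
        unfolded dsrg_matrix_iff[OF ws N(1) V[symmetric]] matrix]
    show ?R using N cardV by auto
  next
    assume R: ?R
    then have N: "card ?V = N" using cardV by simp
    show "dsrg ?G N k \<mu> l t"
      unfolding dsrg_def Let_def
      using R N digraph ws dsrg_matrix_iff[OF ws N V[symmetric], of k t l \<mu>] matrix[of k t l \<mu>]
      unfolding V by blast
  qed
  show ?thesis
  proof
    assume "is_dsrg ?G"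
    then show ?rhs unfolding is_dsrg_def dsrg by (metis of_nat_less_iff)
  next
    assume ?rhs
    then obtain l t :: nat where lt: "0 < t" "int t < 2 * ?s"
      "\<forall>j. cconv (int n) x F j = (int l - int t) * x j + int t" by blast
    then have "int (nat (2 * ?s)) = 2 * ?s" "t < nat (2 * ?s)" by auto
    with lt have "dsrg ?G (2 * n) (nat (2 * ?s)) t l t" unfolding dsrg by blast
    then show "is_dsrg ?G" unfolding is_dsrg_def by blast
  qed
qed

section \<open>Conditions (i) and (ii) in terms of the indicator function\<close>

lemma mod_half_iff:
  fixes j m :: int
  assumes "0 \<le> j" "j < 2 * m"
  shows "2 * m dvd j \<longleftrightarrow> j = 0" and "2 * m dvd j + m \<longleftrightarrow> j = m"
proof -
  show "2 * m dvd j \<longleftrightarrow> j = 0"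
    using assms by (metis dvd_0_right zdvd_not_zless order_le_less)
  have "2 * m dvd j + m \<longleftrightarrow> (j + m) mod (2 * m) = 0" by (rule dvd_eq_mod_eq_0)
  also have "\<dots> \<longleftrightarrow> j = m"
  proof (cases "j < m")
    case True
    then show ?thesis using assms by simp
  next
    case False
    have "(j + m) mod (2 * m) = (j + m - 2 * m) mod (2 * m)" by (metis minus_mod_self2)
    then show ?thesis using assms False by simp
  qed
  finally show "2 * m dvd j + m \<longleftrightarrow> j = m" .
qed

text \<open>\<open>y j\<close> and \<open>y (- j)\<close> are the multiplicities of a residue
  \<open>j\<close> in \<open>H\<close> and in its negative. On the right 0 has multiplicity 0,
  \<open>m\<close> has 2 and all others have 1; periodicity extends the comparison to all
  integers.\<close>

lemma symmetric_multiset_iff: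
  fixes H :: "int set" and M m :: nat
  assumes H: "H \<subseteq> carrier (integer_mod_group M)" and M: "M = 2 * m" "m > 0"
    and y: "\<And>i. y i = of_bool (i mod int M \<in> H)"
  shows "mset_set H + mset_set (set_inv\<^bsub>integer_mod_group M\<^esub> H) =
      mset_set (carrier (integer_mod_group M) - {0}) + {#int m#} \<longleftrightarrow>
    (\<forall>j. symmetrization y j = 1 - of_bool (int M dvd j) + of_bool (int M dvd j + int m))"
proof -
  have car: "carrier (integer_mod_group M) = {0..<int M}"
    using M by (simp add: carrier_integer_mod_group)
  have inv: "set_inv\<^bsub>integer_mod_group M\<^esub> H = {j \<in> {0..<int M}. (- j) mod int M \<in> H}"
  proof -
    have *: "(- (- j mod int M)) mod int M = j" if "j \<in> {0..<int M}" for j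
      using that by (simp add: mod_minus_eq)
    have "set_inv\<^bsub>integer_mod_group M\<^esub> H = (\<lambda>h. (- h) mod int M) ` H"
      using H unfolding SET_INV_def UNION_singleton_eq_range
      by (intro image_cong refl inv_integer_mod_group) blast
    also have "\<dots> = {j \<in> {0..<int M}. (- j) mod int M \<in> H}"
    proof (intro equalityI subsetI)
      fix j assume "j \<in> (\<lambda>h. (- h) mod int M) ` H"
      then obtain h where h: "h \<in> H" "j = (- h) mod int M" by blast
      then have "(- j) mod int M = h" using H *[of h] unfolding car by blast
      then show "j \<in> {j \<in> {0..<int M}. (- j) mod int M \<in> H}" using h M by simp
    next
      fix j assume "j \<in> {j \<in> {0..<int M}. (- j) mod int M \<in> H}"
      then show "j \<in> (\<lambda>h. (- h) mod int M) ` H"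
        using *[of j] by (metis (lifting) image_eqI mem_Collect_eq)
    qed
    finally show ?thesis .
  qed
  define A where "A = set_inv\<^bsub>integer_mod_group M\<^esub> H"
  have A: "j \<in> A \<longleftrightarrow> j \<in> {0..<int M} \<and> (- j) mod int M \<in> H" for j
    unfolding A_def inv by blast
  have fin: "finite H" "finite A"
    using H A unfolding car by (auto intro: finite_subset[of _ "{0..<int M}"])
  let ?P = "\<lambda>j. symmetrization y j = 1 - of_bool (int M dvd j) + of_bool (int M dvd j + int m)"
  have count: "count (mset_set H + mset_set A) j =
      count (mset_set (carrier (integer_mod_group M) - {0}) + {#int m#}) j \<longleftrightarrow>
      (j \<in> {0..<int M} \<longrightarrow> ?P j)" for j
  proof (cases "j \<in> {0..<int M}")
    case True
    then have "int M dvd j \<longleftrightarrow> j = 0" "int M dvd j + int m \<longleftrightarrow> j = int m"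
      using mod_half_iff[of j "int m"] by (simp_all add: M)
    moreover have "j mod int M = j" using True by simp
    ultimately show ?thesis
      using True fin unfolding car
      by (simp add: count_mset_set' symmetrization_def y A)
  next
    case False
    then have "j \<notin> H" "j \<notin> A" "j \<notin> carrier (integer_mod_group M)" "j \<noteq> int m"
      using H M A unfolding car by auto
    then show ?thesis
      using False by (simp add: count_mset_set' del: atLeastLessThan_iff)
  qed
  have "?P (j mod int M) \<longleftrightarrow> ?P j" for j
  proof -
    have "int M dvd j mod int M + int m \<longleftrightarrow> int M dvd j + int m"
      by (simp add: dvd_eq_mod_eq_0 mod_simps)
    moreover have "symmetrization y (j mod int M) = symmetrization y j"
      by (simp add: symmetrization_def y mod_minus_eq)
    ultimately show ?thesis by (simp add: dvd_mod_iff)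
  qed
  moreover have "j mod int M \<in> {0..<int M}" for j using M by simp
  ultimately have "(\<forall>j\<in>{0..<int M}. ?P j) \<longleftrightarrow> (\<forall>j. ?P j)" by blast
  then show ?thesis unfolding A_def[symmetric] multiset_eq_iff count by blast
qed

lemma half_shift_disjoint_iff:
  fixes H :: "int set" and M m :: nat
  assumes H: "H \<subseteq> carrier (integer_mod_group M)" and M: "M = 2 * m" "m > 0"
    and y: "\<And>i. y i = (of_bool (i mod int M \<in> H) :: int)"
  shows "H \<inter> (int m <#\<^bsub>integer_mod_group M\<^esub> H) = {} \<longleftrightarrow> (\<forall>j. y j + y (j + int m) \<le> 1)"
proof -
  have car: "carrier (integer_mod_group M) = {0..<int M}"
    using M by (simp add: carrier_integer_mod_group)
  have self: "h mod int M = h" if "h \<in> H" for h using H that unfolding car by auto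
  have "H \<inter> (int m <#\<^bsub>integer_mod_group M\<^esub> H) = {} \<longleftrightarrow> (\<forall>h\<in>H. (h + int m) mod int M \<notin> H)"
    by (auto simp: l_coset_def add.commute)
  also have "\<dots> \<longleftrightarrow> (\<forall>j. \<not> (j mod int M \<in> H \<and> (j + int m) mod int M \<in> H))"
  proof -
    have "(j mod int M + int m) mod int M = (j + int m) mod int M" for j by (simp add: mod_simps)
    then show ?thesis using self by metis
  qed
  also have "\<dots> \<longleftrightarrow> (\<forall>j. y j + y (j + int m) \<le> 1)"
    by (simp add: y)
  finally show ?thesis .
qed

text \<open>Summing \<open>F\<close> over a period gives the sum of \<open>x\<close>. Hence
  \<open>x j + x (j + int m)\<close> has average 1, and the bound \<open>half\<close> is an equality
  everywhere. Convolving \<open>x\<close> with the three terms of \<open>F\<close> then gives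
  \<open>int m - x j + x (j - int m)\<close>.\<close>

lemma cconv_of_half_structure:
  fixes M m :: nat
  assumes x: "periodic_indicator (int M) x" and M: "M = 2 * m"
    and F: "\<And>j. symmetrization x j = 1 - of_bool (int M dvd j) + of_bool (int M dvd j + int m)"
    and half: "\<And>j. x j + x (j + int m) \<le> 1"
  shows "(\<Sum>i\<in>{0..<int M}. x i) = int m"
    and "cconv (int M) x (symmetrization x) j = int m + 1 - 2 * x j"
proof -
  interpret periodic_indicator "int M" x by (rule x)
  have dvd: "int M dvd j + int m \<longleftrightarrow> int M dvd j - int m" for j
  proof -
    have "j + int m = (j - int m) + int M" by (simp add: M)
    then show ?thesis by (metis dvd_add_triv_right_iff)
  qed
  have F': "F = (\<lambda>j. 1 - of_bool (int M dvd j - 0) + of_bool (int M dvd j - int m))"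
    by (simp add: fun_eq_iff F dvd)
  have delta: "(\<Sum>i\<in>{0..<int M}. of_bool (int M dvd a - i)) = (1::int)" for a
    using cconv_delta[of "int M" "\<lambda>_. 1" 0 a] M_pos by (simp add: cconv_def periodic_def)
  have delta': "(\<Sum>i\<in>{0..<int M}. of_bool (int M dvd i - a)) = (1::int)" for a
    using delta[of a] by (simp add: dvd_diff_commute)
  have "(\<Sum>i\<in>{0..<int M}. F i) = int M"
    unfolding F' using delta'[of 0] delta'[of "int m"] by (simp add: sum.distrib sum_subtractf)
  then show s: "(\<Sum>i\<in>{0..<int M}. x i) = int m" using sum_F M by simp
  have "(\<Sum>i\<in>{0..<int M}. 1 - (x i + x (i + int m))) = 0"
    using s sum_periodic_shift[OF x_periodic M_pos, of "int m"] M
    by (simp add: sum.distrib sum_subtractf)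
  then have "1 - (x (j mod int M) + x (j mod int M + int m)) = 0"
    using half M_pos by (subst (asm) sum_nonneg_eq_0_iff) auto
  moreover have "x (j mod int M + int m) = x (j - int m)"
  proof (rule periodic_cong[OF x_periodic])
    have "j mod int M + int m - (j - int m) = (j mod int M - j) + int M" by (simp add: M)
    moreover have "int M dvd j mod int M - j" by (simp add: mod_eq_dvd_iff[symmetric])
    ultimately show "int M dvd j mod int M + int m - (j - int m)"
      by (metis dvd_add_triv_right_iff)
  qed
  ultimately have "x (j - int m) = 1 - x j" by (simp add: periodic_mod[OF x_periodic])
  then show "cconv (int M) x F j = int m + 1 - 2 * x j"
    unfolding F'
    by (simp only: cconv_diff_right cconv_add_right cconv_delta[OF x_periodic M_pos]
        cconv_const_right s) simp
qed

section \<open>Descent to the least period and the equivalence\<close>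

lemma dihedrant_equation_imp_structure:
  fixes \<alpha> :: nat
  assumes x: "periodic_indicator (2 ^ \<alpha>) x"
    and "0 < \<mu>" and genuine: "\<mu> < 2 * (\<Sum>i\<in>{0..<2 ^ \<alpha>}. x i)"
    and conv: "\<And>j. cconv (2 ^ \<alpha>) x (symmetrization x) j = \<delta> * x j + \<mu>"
  obtains \<gamma> where "2 \<le> \<gamma>" "\<gamma> \<le> \<alpha>" "periodic (2 ^ \<gamma>) x"
    "\<And>j. symmetrization x j = 1 - of_bool (2 ^ \<gamma> dvd j) + of_bool (2 ^ \<gamma> dvd j + 2 ^ (\<gamma> - 1))"
    "\<And>j. x j + x (j + 2 ^ (\<gamma> - 1)) = 1"
proof -
  interpret N: periodic_indicator "2 ^ \<alpha>" x by (rule x)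
  define \<gamma> where "\<gamma> = (LEAST g. periodic (2 ^ g) x)"
  have per: "periodic (2 ^ \<gamma>) x"
    unfolding \<gamma>_def by (rule LeastI) (rule N.x_periodic)
  have le: "\<gamma> \<le> \<alpha>"
    unfolding \<gamma>_def by (rule Least_le) (rule N.x_periodic)
  have "\<gamma> \<noteq> 0"
  proof
    assume "\<gamma> = 0"
    then have "x i = 0" for i using periodic_cong[OF per, of i 0] N.x_0 by simp
    then show False using assms(2) genuine by simp
  qed
  then obtain k where k: "\<gamma> = Suc k" by (cases \<gamma>) auto
  have aper: "\<not> periodic (2 ^ k) x"
    using not_less_Least[of k "\<lambda>g. periodic (2 ^ g) x"] k by (simp add: \<gamma>_def)
  interpret M: periodic_indicator "2 ^ \<gamma>" x
    by unfold_locales (use per N.x_01 N.x_0 in auto)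
  define c :: nat where "c = 2 ^ (\<alpha> - \<gamma>)"
  have c: "(2 ^ \<alpha> :: int) = 2 ^ \<gamma> * int c" "c > 0"
    using le by (simp_all add: c_def power_add[symmetric])
  let ?C = "cconv (2 ^ \<gamma>) x M.F"
  have convM: "int c * ?C j = \<delta> * x j + \<mu>" for j
    using conv[of j] cconv_mult_modulus[OF M.x_periodic M.F_periodic M.M_pos, of c j] c(1) by simp
  \<comment> \<open>Evaluating where \<open>x\<close> is 0 and where it is 1 shows that both
    coefficients are multiples of the number \<open>c\<close> of periods, so the equation can be
    divided by \<open>c\<close>.\<close>
  have mu: "\<mu> = int c * ?C 0" using convM[of 0] by (simp add: N.x_0)
  obtain i where i: "x i = 1"
    using genuine assms(2) N.x_01 by (metis less_asym mult_zero_right sum.neutral)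
  have delta: "\<delta> = int c * (?C i - ?C 0)" using convM[of i] mu i by (simp add: algebra_simps)
  have conv': "?C j = (?C i - ?C 0) * x j + ?C 0" for j
  proof -
    have "int c * ?C j = int c * ((?C i - ?C 0) * x j + ?C 0)"
      using convM[of j] unfolding mu delta by (simp add: algebra_simps)
    then show ?thesis using c(2) by simp
  qed
  have "int c * ?C 0 < int c * (2 * (\<Sum>i\<in>{0..<2 ^ \<gamma>}. x i))"
    using genuine sum_periodic_mult[OF M.x_periodic M.M_pos, of c] unfolding mu c(1) by simp
  then have genM: "?C 0 < 2 * (\<Sum>i\<in>{0..<2 ^ \<gamma>}. x i)"
    using c(2) by (simp only: mult_less_cancel_left_pos of_nat_0_less_iff)
  interpret half_aperiodic "2 ^ \<gamma>" x "2 ^ k" k "?C i - ?C 0" "?C 0"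
  proof unfold_locales
    show "(2 ^ \<gamma> :: int) = 2 * int (2 ^ k)" by (simp add: k)
    show "\<not> periodic (int (2 ^ k)) x" using aper by simp
  qed (fact conv' genM refl)+
  show ?thesis
  proof
    show "2 \<le> \<gamma>" using k_pos k by simp
    show "\<gamma> \<le> \<alpha>" by (rule le)
    show "periodic (2 ^ \<gamma>) x" by (rule per)
    show "symmetrization x j = 1 - of_bool (2 ^ \<gamma> dvd j) + of_bool (2 ^ \<gamma> dvd j + 2 ^ (\<gamma> - 1))" for j
      using F_eq[of j] k by simp
    show "x j + x (j + 2 ^ (\<gamma> - 1)) = 1" for j
      using x_add_half[of j] k by simp
  qed
qed

theorem theorem6p3:
  fixes \<alpha> :: nat and X :: "int set"
  assumes "\<alpha> > 0"
    and "X \<subseteq> carrier (integer_mod_group (2 ^ \<alpha>)) - {0}"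
  shows "is_dsrg (Dih (2 ^ \<alpha>) X X) \<longleftrightarrow>
    (\<exists>\<gamma> H. 2 \<le> \<gamma> \<and> \<gamma> \<le> \<alpha> \<and> H \<subseteq> carrier (integer_mod_group (2 ^ \<gamma>)) \<and>
      X = {i \<in> carrier (integer_mod_group (2 ^ \<alpha>)). psi \<gamma> i \<in> H} \<and>
      mset_set H + mset_set (set_inv\<^bsub>integer_mod_group (2 ^ \<gamma>)\<^esub> H) =
        mset_set (carrier (integer_mod_group (2 ^ \<gamma>)) - {0}) + {#2 ^ (\<gamma> - 1)#} \<and>
      H \<inter> (2 ^ (\<gamma> - 1) <#\<^bsub>integer_mod_group (2 ^ \<gamma>)\<^esub> H) = {})"
    (is "_ \<longleftrightarrow> (\<exists>\<gamma> H. ?S \<gamma> H)")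
proof -
  have car: "carrier (integer_mod_group (2 ^ g)) = {0..<2 ^ g}" for g
    by (simp add: carrier_integer_mod_group)
  define x :: "int \<Rightarrow> int" where "x i = of_bool (i mod 2 ^ \<alpha> \<in> X)" for i
  have X: "X \<subseteq> {0..<2 ^ \<alpha>} - {0}" using assms(2) unfolding car .
  interpret N: periodic_indicator "2 ^ \<alpha>" x
    by unfold_locales (use X in \<open>auto simp: x_def periodic_def\<close>)
  have dsrg: "is_dsrg (Dih (2 ^ \<alpha>) X X) \<longleftrightarrow>
    (\<exists>l t :: nat. 0 < t \<and> int t < 2 * (\<Sum>i\<in>{0..<2 ^ \<alpha>}. x i) \<and>
      (\<forall>j. cconv (2 ^ \<alpha>) x (symmetrization x) j = (int l - int t) * x j + int t))"
    using is_dsrg_Dih_iff[of "2 ^ \<alpha>" X x] X by (simp add: x_def)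
  have x_X: "i \<in> X \<longleftrightarrow> i \<in> {0..<2 ^ \<alpha>} \<and> x i = 1" for i
    using X by (auto simp: x_def)
  have struct_iff: "mset_set H + mset_set (set_inv\<^bsub>integer_mod_group (2 ^ \<gamma>)\<^esub> H) =
        mset_set (carrier (integer_mod_group (2 ^ \<gamma>)) - {0}) + {#2 ^ (\<gamma> - 1)#} \<and>
      H \<inter> (2 ^ (\<gamma> - 1) <#\<^bsub>integer_mod_group (2 ^ \<gamma>)\<^esub> H) = {} \<longleftrightarrow>
      (\<forall>j. symmetrization x j = 1 - of_bool (2 ^ \<gamma> dvd j) + of_bool (2 ^ \<gamma> dvd j + 2 ^ (\<gamma> - 1))) \<and>
      (\<forall>j. x j + x (j + 2 ^ (\<gamma> - 1)) \<le> 1)"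
    if "2 \<le> \<gamma>" "H \<subseteq> carrier (integer_mod_group (2 ^ \<gamma>))" "\<And>i. x i = of_bool (i mod 2 ^ \<gamma> \<in> H)"
    for \<gamma> H
  proof -
    have M: "(2 ^ \<gamma> :: nat) = 2 * 2 ^ (\<gamma> - 1)" "(2 ^ (\<gamma> - 1) :: nat) > 0"
      using that(1) by (simp_all flip: power_Suc)
    show ?thesis
      using symmetric_multiset_iff[OF that(2) M, of x] half_shift_disjoint_iff[OF that(2) M, of x]
        that(3) by simp
  qed
  show ?thesis
  proof
    assume "is_dsrg (Dih (2 ^ \<alpha>) X X)"
    then obtain l t :: nat where lt: "0 < int t" "int t < 2 * (\<Sum>i\<in>{0..<2 ^ \<alpha>}. x i)"
      "\<And>j. cconv (2 ^ \<alpha>) x (symmetrization x) j = (int l - int t) * x j + int t"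
      unfolding dsrg by auto
    obtain \<gamma> where \<gamma>: "2 \<le> \<gamma>" "\<gamma> \<le> \<alpha>" "periodic (2 ^ \<gamma>) x"
      "\<And>j. symmetrization x j = 1 - of_bool (2 ^ \<gamma> dvd j) + of_bool (2 ^ \<gamma> dvd j + 2 ^ (\<gamma> - 1))"
      "\<And>j. x j + x (j + 2 ^ (\<gamma> - 1)) = 1"
      using dihedrant_equation_imp_structure[OF N.periodic_indicator_axioms lt] by metis
    define H where "H = {j \<in> {0..<2 ^ \<gamma>}. x j = 1}"
    have H: "H \<subseteq> carrier (integer_mod_group (2 ^ \<gamma>))" by (auto simp: H_def car)
    have x_H: "x i = of_bool (i mod 2 ^ \<gamma> \<in> H)" for i
      using N.x_01[of i] by (auto simp: H_def periodic_mod[OF \<gamma>(3)])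
    have "X = {i \<in> carrier (integer_mod_group (2 ^ \<alpha>)). psi \<gamma> i \<in> H}"
      unfolding car psi_def using x_X x_H by auto
    moreover have "x j + x (j + 2 ^ (\<gamma> - 1)) \<le> 1" for j using \<gamma>(5)[of j] by simp
    ultimately have "?S \<gamma> H"
      using \<gamma>(1,2) H \<gamma>(4) by (simp only: struct_iff[OF \<gamma>(1) H x_H]) simp
    then show "\<exists>\<gamma> H. ?S \<gamma> H" by blast
  next
    assume "\<exists>\<gamma> H. ?S \<gamma> H"
    then obtain \<gamma> H where S: "?S \<gamma> H" by blast
    define m :: nat where "m = 2 ^ (\<gamma> - 1)"
    define c :: nat where "c = 2 ^ (\<alpha> - \<gamma>)"
    have "2 \<le> \<gamma>" using S by blast
    then have M: "(2 ^ \<gamma> :: nat) = 2 * m" and "m > 1"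
      using one_less_power[of "2::nat" "\<gamma> - 1"] by (simp_all add: m_def flip: power_Suc)
    have c: "(2 ^ \<alpha> :: int) = int (2 ^ \<gamma>) * int c" "c > 0"
      using S by (simp_all add: c_def power_add[symmetric])
    have x_H: "x i = of_bool (i mod 2 ^ \<gamma> \<in> H)" for i
    proof -
      have "(i mod 2 ^ \<alpha>) mod 2 ^ \<gamma> = i mod 2 ^ \<gamma>"
        using c(1) by (simp add: mod_mod_cancel)
      moreover have "i mod 2 ^ \<alpha> \<in> X \<longleftrightarrow> psi \<gamma> (i mod 2 ^ \<alpha>) \<in> H"
        using S unfolding car by auto
      ultimately show ?thesis by (simp add: x_def psi_def)
    qed
    interpret M: periodic_indicator "int (2 ^ \<gamma>)" x
      by unfold_locales (use N.x_0 in \<open>auto simp: x_H periodic_def\<close>)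
    have F: "symmetrization x j =
        1 - of_bool (int (2 ^ \<gamma>) dvd j) + of_bool (int (2 ^ \<gamma>) dvd j + int m)"
      and half: "x j + x (j + int m) \<le> 1" for j
      using struct_iff[of \<gamma> H] S x_H by (auto simp: m_def)
    note eq = cconv_of_half_structure[OF M.periodic_indicator_axioms M F half]
    \<comment> \<open>Multiplying \<open>int m + 1 - 2 * x j\<close> by \<open>c\<close> gives
      \<open>t = c * (m + 1)\<close> and \<open>l - t = - 2 * c\<close>. The degree is
      \<open>2 * c * m\<close>, so \<open>t\<close> is smaller exactly because
      \<open>m > 1\<close>.\<close>
    define t l where "t = c * (m + 1)" and "l = c * (m - 1)"
    have "0 < t" using c(2) by (simp add: t_def)
    moreover have "(\<Sum>i\<in>{0..<2 ^ \<alpha>}. x i) = int c * int m"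
      using sum_periodic_mult[OF M.x_periodic M.M_pos, of c] c(1) eq(1) by simp
    then have "int t < 2 * (\<Sum>i\<in>{0..<2 ^ \<alpha>}. x i)"
      using \<open>m > 1\<close> c(2) by (simp add: t_def algebra_simps)
    moreover have "cconv (2 ^ \<alpha>) x (symmetrization x) j = (int l - int t) * x j + int t" for j
    proof -
      have "cconv (2 ^ \<alpha>) x (symmetrization x) j = int c * (int m + 1 - 2 * x j)"
        unfolding c(1) cconv_mult_modulus[OF M.x_periodic M.F_periodic M.M_pos] eq(2) ..
      then show ?thesis using \<open>m > 1\<close> by (simp add: t_def l_def of_nat_diff algebra_simps)
    qed
    ultimately show "is_dsrg (Dih (2 ^ \<alpha>) X X)" unfolding dsrg by blast
  qed
qed

end
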